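(* Let $0\le M\le N$ be integers, $a=(a_1,\dots,a_M)$ and $b=(b_0,b_1,\dots,b_N)$ with all entries positive, and $q\in\mathbb{C}\setminus(-\infty,-b_0]$. Writing $\Omega=\sum_{i=1}^Mn_ia_i$, $$\eta_{M,N}(q\,|\,a,b)=\prod_{n_1,\dots,n_M=0}^\infty\Bigl[\frac{b_0+\Omega}{q+b_0+\Omega}\prod_{j_1=1}^N\frac{q+b_0+b_{j_1}+\Omega}{b_0+b_{j_1}+\Omega}\prod_{j_1<j_2}^N\frac{b_0+b_{j_1}+b_{j_2}+\Omega}{q+b_0+b_{j_1}+b_{j_2}+\Omega}\cdots\Bigr],$$ where the bracket is $\prod_{J\subseteq\{1,\dots,N\}}\Bigl(\frac{q+b_0+\sum_{j\in J}b_j+\Omega}{b_0+\sum_{j\in J}b_j+\Omega}\Bigr)^{(-1)^{|J|+1}}$. Probabilistically, $$\beta_{M,N}(a,b)\overset{\text{in law}}{=}\prod_{n_1,\dots,n_M=0}^\infty\beta_{0,N}(b_0+\Omega),$$ where the factors on the right are independent and $\beta_{0,N}(b_0+\Omega)$ denotes the Barnes beta distribution $\beta_{0,N}$ with parameters $(b_0+\Omega,b_1,\dots,b_N)$.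
   Context: Barnes multiple log-gamma function: for $a=(a_1,\dots,a_M)$, $a_j>0$, $\zeta_M(s,w\,|\,a)=\sum_{k_1,\dots,k_M=0}^\infty(w+k_1a_1+\cdots+k_Ma_M)^{-s}$ for $\Re(s)>M$, $\Re(w)>0$, continued meromorphically in $s$; $L_M(w\,|\,a)=\partial_s\zeta_M(s,w\,|\,a)|_{s=0}$, continued analytically to $w\in\mathbb{C}\setminus(-\infty,0]$; $L_0(w)=-\log w$. Operator $\mathcal{S}_N$: $(\mathcal{S}_Nh)(q\,|\,b)=\sum_{J\subseteq\{1,\dots,N\}}(-1)^{|J|}h\bigl(q+b_0+\sum_{j\in J}b_j\bigr)$. Barnes beta distribution: for $M\le N$ the function $\eta_{M,N}(q\,|\,a,b)=\exp\bigl((\mathcal{S}_NL_M)(q\,|\,a,b)-(\mathcal{S}_NL_M)(0\,|\,a,b)\bigr)$ (with $h=L_M(\cdot\,|\,a)$), $q\in\mathbb{C}\setminus(-\infty,-b_0]$, is known to be the Mellin transform of a unique probability distribution on $(0,1]$; a random variable with this law is denoted $\beta_{M,N}(a,b)$ (for $M=0$ there are no parameters $a$), i.e. $\mathbf{E}[\beta_{M,N}(a,b)^q]=\eta_{M,N}(q\,|\,a,b)$ for $\Re(q)>-b_0$. *)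

theory Defs
  imports "HOL-Complex_Analysis.Complex_Analysis" "HOL-Probability.Probability"
begin

text \<open>
  Parameter tuples are functions on \<open>nat\<close>: only the values \<open>a 1, \<dots>, a M\<close> and
  \<open>b 0, \<dots>, b N\<close> are used.  Multi-indices \<open>(n\<^sub>1, \<dots>, n\<^sub>M)\<close> are extensional functions on
  \<open>{1..M}\<close>, so that there is exactly one of them when \<open>M = 0\<close>.
\<close>

definition multi_indices :: "nat \<Rightarrow> (nat \<Rightarrow> nat) set" where
  "multi_indices M = PiE {1..M} (\<lambda>_. UNIV)"

definition barnes_Omega :: "nat \<Rightarrow> (nat \<Rightarrow> real) \<Rightarrow> (nat \<Rightarrow> nat) \<Rightarrow> real" where
  "barnes_Omega M a n = (\<Sum>i=1..M. real (n i) * a i)"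

definition barnes_zeta_series :: "nat \<Rightarrow> (nat \<Rightarrow> real) \<Rightarrow> complex \<Rightarrow> complex \<Rightarrow> complex" where
  "barnes_zeta_series M a s w =
     (\<Sum>\<^sub>\<infinity>k\<in>multi_indices M. (w + of_real (barnes_Omega M a k)) powr (- s))"

text \<open>
  The meromorphic continuation in \<open>s\<close>, for fixed \<open>w\<close> with positive real part.  The library's
  notion \<open>nicely_meromorphic_on\<close> (removable singularities removed, value 0 at poles) makes the
  continuation unique as a function, and it is holomorphic at every point that is not a pole.
\<close>

definition barnes_zeta :: "nat \<Rightarrow> (nat \<Rightarrow> real) \<Rightarrow> complex \<Rightarrow> complex \<Rightarrow> complex" where
  "barnes_zeta M a s w =
     (THE Z. Z nicely_meromorphic_on UNIV \<and>
             (\<forall>s. Re s > real M \<longrightarrow> Z s = barnes_zeta_series M a s w)) s"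

text \<open>
  \<open>L\<^sub>M(w | a)\<close>, continued analytically from the right half-plane to the slit plane.  The values
  on the slit plane are determined by the identity theorem; the values on the cut are arbitrary
  and never used.
\<close>

definition barnes_L :: "nat \<Rightarrow> (nat \<Rightarrow> real) \<Rightarrow> complex \<Rightarrow> complex" where
  "barnes_L M a w =
     (if M = 0 then - Ln w
      else (SOME f. f holomorphic_on (- \<real>\<^sub>\<le>\<^sub>0) \<and>
              (\<forall>w. Re w > 0 \<longrightarrow> f w = deriv (\<lambda>s. barnes_zeta M a s w) 0)) w)"

definition barnes_S :: "nat \<Rightarrow> (complex \<Rightarrow> complex) \<Rightarrow> (nat \<Rightarrow> real) \<Rightarrow> complex \<Rightarrow> complex" where
  "barnes_S N h b q =
     (\<Sum>J\<in>Pow {1..N}. (-1) ^ card J * h (q + of_real (b 0 + (\<Sum>j\<in>J. b j))))"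

definition barnes_eta ::
    "nat \<Rightarrow> nat \<Rightarrow> (nat \<Rightarrow> real) \<Rightarrow> (nat \<Rightarrow> real) \<Rightarrow> complex \<Rightarrow> complex" where
  "barnes_eta M N a b q = exp (barnes_S N (barnes_L M a) b q - barnes_S N (barnes_L M a) b 0)"

definition barnes_factor ::
    "nat \<Rightarrow> nat \<Rightarrow> (nat \<Rightarrow> real) \<Rightarrow> (nat \<Rightarrow> real) \<Rightarrow> complex \<Rightarrow> (nat \<Rightarrow> nat) \<Rightarrow> complex" where
  "barnes_factor M N a b q n =
     (\<Prod>J\<in>Pow {1..N}.
        ((q + of_real (b 0 + (\<Sum>j\<in>J. b j) + barnes_Omega M a n)) /
         of_real (b 0 + (\<Sum>j\<in>J. b j) + barnes_Omega M a n)) powi ((-1) ^ (card J + 1)))"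

text \<open>
  \<open>D\<close> is the law of the Barnes beta distribution \<open>\<beta>\<^sub>M\<^sub>,\<^sub>N(a, b)\<close>: the probability distribution on
  \<open>(0,1]\<close>, viewed as a Borel measure on the line, with Mellin transform \<open>barnes_eta\<close>.
  For \<open>M = 0\<close> the argument \<open>a\<close> is irrelevant.
\<close>

definition barnes_beta_law ::
    "nat \<Rightarrow> nat \<Rightarrow> (nat \<Rightarrow> real) \<Rightarrow> (nat \<Rightarrow> real) \<Rightarrow> real measure \<Rightarrow> bool" where
  "barnes_beta_law M N a b D \<longleftrightarrow>
     prob_space D \<and> sets D = sets borel \<and> (AE x in D. 0 < x \<and> x \<le> 1) \<and>
     (\<forall>q. Re q > - b 0 \<longrightarrow>
        has_bochner_integral D (\<lambda>x. complex_of_real x powr q) (barnes_eta M N a b q))"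

end

theory Submission
  imports Defs
begin

text \<open>
  For \<open>Re s > M\<close>, \<open>\<S>\<^sub>N \<zeta>\<^sub>M(s, \<cdot>)(q) - \<S>\<^sub>N \<zeta>\<^sub>M(s, \<cdot>)(0)\<close> is the sum over the lattice of
  \<open>(N + 1)\<close>-fold differences of \<open>(\<cdot> + \<Omega>) powr (-s)\<close>.  These are \<open>O(\<Omega> powr (- Re s - N - 1))\<close>, so for \<open>M \<le> N\<close> the
  series converges and is holomorphic near \<open>s = 0\<close>, where it may be differentiated termwise.
  The terms then become the logarithms of the factors in the product formula.  The
  meromorphic continuation of \<open>\<zeta>\<^sub>M\<close> is obtained strip by strip from the difference equation
  \<open>\<zeta>\<^sub>M(s, w) - \<zeta>\<^sub>M(s, w + a\<^sub>M) = \<zeta>\<^sub>M\<^sub>-\<^sub>1(s, w)\<close>, directly for \<open>w\<close> in the slit plane.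

  For the identity in law, partial products of the independent variables decrease, and
  their Mellin transforms are partial products of the product formula.  Mellin transforms
  determine laws on \<open>(0,1]\<close>.
\<close>

text \<open>The definitions fix \<open>barnes_zeta\<close> and \<open>barnes_L\<close> only through
  a definite description and a choice. Before the lattice series for the difference can say anything
  about \<open>barnes_L\<close>, the full continuation must therefore exist: meromorphic in
  \<open>s\<close>, with an \<open>s\<close>-derivative at 0 that is holomorphic in
  \<open>w\<close>. The second point is why bounds uniform on compact sets in both variables are
  carried along. Poles are kept out of the induction by a Pochhammer factor, which is divided out
  near 0 only in the region \<open>Re s < 1\<close>, where it has no zeros.

  The slit plane suits the argument because it is stable under adding nonnegative reals:
  \<open>w + \<Omega>\<close> never meets the cut of the principal power, and its modulus is
  comparable to \<open>1 + \<Omega>\<close> even when \<open>Re w < 0\<close>. Thus every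
  \<open>q\<close> off the cut is treated at once.

  On the probabilistic side, a decreasing product could lose mass to 0. The interval between
  \<open>- b 0\<close> and 0 leaves room for negative moments, whose boundedness comes from the
  product formula.\<close>

section \<open>Geometry of the slit plane and bounds for complex powers\<close>

abbreviation slit_plane :: "complex set" where
  "slit_plane \<equiv> - \<real>\<^sub>\<le>\<^sub>0"

lemma slit_plane_add: "z \<in> slit_plane \<Longrightarrow> 0 \<le> x \<Longrightarrow> z + of_real x \<in> slit_plane"
  by (auto simp: complex_nonpos_Reals_iff)

lemma open_slit_plane: "open slit_plane"
  by (simp add: open_Compl)

text \<open>The slit plane is star-shaped about every positive real: a point of the segment other
  than its positive endpoint is real only if \<open>z\<close> is, and then both endpoints are
  positive.\<close>

lemma closed_segment_subset_slit_plane: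
  assumes "z \<in> slit_plane" "r > 0"
  shows "closed_segment (of_real r) z \<subseteq> slit_plane"
proof
  fix w assume "w \<in> closed_segment (of_real r) z"
  then obtain u where u: "0 \<le> u" "u \<le> 1" "w = (1 - u) *\<^sub>R of_real r + u *\<^sub>R z"
    by (auto simp: closed_segment_def)
  show "w \<in> slit_plane"
  proof (cases "Im z = 0 \<or> u = 0")
    case True
    hence "u = 0 \<or> Im z = 0 \<and> Re z > 0 \<and> u > 0" using assms(1) u
      by (cases "Im z = 0") (auto simp: complex_nonpos_Reals_iff)
    thus ?thesis
    proof
      assume *: "Im z = 0 \<and> Re z > 0 \<and> u > 0"
      hence "(1 - u) * r + u * Re z > 0" using u assms(2)
        by (intro add_nonneg_pos) auto
      thus ?thesis by (auto simp: complex_nonpos_Reals_iff u)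
    qed (use assms in \<open>auto simp: complex_nonpos_Reals_iff u\<close>)
  next
    case False
    thus ?thesis by (auto simp: complex_nonpos_Reals_iff u)
  qed
qed

lemma connected_slit_plane: "connected slit_plane"
proof -
  have "closed_segment 1 z \<subseteq> slit_plane" if "z \<in> slit_plane" for z
    using closed_segment_subset_slit_plane[OF that, of 1] by simp
  moreover have "1 \<in> slit_plane" by simp
  ultimately have "starlike slit_plane" unfolding starlike_def by blast
  thus ?thesis by (rule starlike_imp_connected)
qed

lemma compact_add_reals:
  fixes K :: "complex set"
  assumes "compact K"
  shows "compact ((\<lambda>(w, x). w + of_real x) ` (K \<times> {0..r}))"
  by (rule compact_continuous_image)
     (auto intro!: compact_Times assms continuous_intros simp: case_prod_unfold)

lemma add_reals_subset_slit_plane: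
  assumes "K \<subseteq> slit_plane"
  shows "(\<lambda>(w, x). w + of_real x) ` (K \<times> {0..r}) \<subseteq> slit_plane"
  using assms slit_plane_add by fastforce

text \<open>For bounded \<open>x\<close> the points \<open>w + x\<close> fill a compact set that
  stays away from 0; for large \<open>x\<close> the shift dominates \<open>w\<close>.\<close>

lemma compact_slit_plane_lower_bound:
  assumes "compact K" "K \<subseteq> slit_plane"
  obtains c where "c > 0" "\<And>w x. w \<in> K \<Longrightarrow> 0 \<le> x \<Longrightarrow> c * (1 + x) \<le> norm (w + of_real x)"
proof -
  obtain R where R: "R > 0" "\<And>w. w \<in> K \<Longrightarrow> norm w \<le> R"
    using compact_imp_bounded[OF assms(1)] by (auto simp: bounded_pos)
  define K' where "K' = (\<lambda>(w, x). w + complex_of_real x) ` (K \<times> {0..2*R+1})"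
  have "compact K'" unfolding K'_def by (intro compact_add_reals assms)
  moreover have "0 \<notin> K'" using add_reals_subset_slit_plane[OF assms(2)] unfolding K'_def by force
  ultimately obtain d where d: "d > 0" "\<And>y. y \<in> K' \<Longrightarrow> d \<le> dist 0 y"
    using separate_point_closed[of K' 0] compact_imp_closed by blast
  \<comment> \<open>The value \<open>1/4\<close> serves \<open>x > 2*R+1\<close>, where
    \<open>x - R\<close> exceeds \<open>(1 + x) / 2\<close>. The other serves the remaining
    \<open>x\<close>, where \<open>1 + x\<close> is at most \<open>2*R+2\<close> and the modulus at
    least \<open>d\<close>.\<close>
  define c where "c = min (1/4) (d / (2*R+2))"
  show thesis
  proof
    show "c > 0" using d R by (simp add: c_def)
    fix w :: complex and x :: real assume w: "w \<in> K" "0 \<le> x"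
    show "c * (1 + x) \<le> norm (w + of_real x)"
    proof (cases "x \<le> 2*R+1")
      case True
      have "w + of_real x \<in> K'" unfolding K'_def using w True by force
      hence "d \<le> norm (w + of_real x)" using d by fastforce
      moreover have "c * (1 + x) \<le> d / (2*R+2) * (2*R+2)" using True w R d
        by (intro mult_mono) (auto simp: c_def)
      ultimately show ?thesis using R by simp
    next
      case False
      have "x = norm ((w + of_real x) - w)" using w by simp
      also have "\<dots> \<le> norm (w + of_real x) + R"
        using norm_triangle_ineq4[of "w + of_real x" w] R(2)[OF w(1)] by linarith
      finally have "x - R \<le> norm (w + of_real x)" by simp
      moreover have "c * (1 + x) \<le> 1/4 * (1 + x)" using w by (intro mult_right_mono) (auto simp: c_def min_def)
      ultimately show ?thesis using False R by argo
    qed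
  qed
qed

lemma compact_continuous_bound:
  fixes f :: "'a::topological_space \<Rightarrow> 'b::real_normed_vector"
  assumes "compact K" "continuous_on K f"
  obtains B where "B > 0" "\<And>x. x \<in> K \<Longrightarrow> norm (f x) \<le> B"
proof -
  have "bounded (f ` K)" using assms by (intro compact_imp_bounded compact_continuous_image)
  thus thesis using that by (auto simp: bounded_pos)
qed

lemma norm_powr_bound:
  assumes "z \<noteq> 0"
  shows "norm (z powr s) \<le> exp (pi * \<bar>Im s\<bar>) * norm z powr Re s"
proof -
  have "norm (z powr s) = exp (Re s * ln (norm z) - Im s * Im (Ln z))"
    using assms by (simp add: powr_def)
  also have "\<dots> \<le> exp (pi * \<bar>Im s\<bar> + Re s * ln (norm z))"
  proof -
    have "\<bar>Im (Ln z)\<bar> \<le> pi" using assms Im_Ln_le_pi mpi_less_Im_Ln by (simp add: abs_le_iff less_imp_le) (smt (verit))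
    hence "\<bar>Im s\<bar> * \<bar>Im (Ln z)\<bar> \<le> \<bar>Im s\<bar> * pi" by (intro mult_left_mono) auto
    hence "\<bar>Im s * Im (Ln z)\<bar> \<le> \<bar>Im s\<bar> * pi" by (simp add: abs_mult)
    thus ?thesis by (simp add: mult.commute) 
  qed
  finally show ?thesis using assms by (simp add: exp_add powr_def)
qed

text \<open>The ratio of \<open>norm (w + x)\<close> to \<open>1 + x\<close> lies between
  \<open>c\<close> and \<open>Q\<close>. Since \<open>Re s\<close> may have either sign, both bounds
  enter, through the absolute value of the logarithm of the ratio. Replacing \<open>Re s\<close> by
  \<open>\<tau>\<close> uses \<open>1 + x \<ge> 1\<close>, and the factor
  \<open>exp (pi * R)\<close> pays for the argument of the complex base.\<close>

lemma powr_shift_bound: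
  assumes "compact K1" "compact K2" "K2 \<subseteq> slit_plane" "\<And>s. s \<in> K1 \<Longrightarrow> \<tau> \<le> Re s"
  obtains C where "C \<ge> 0" "\<And>s w x. s \<in> K1 \<Longrightarrow> w \<in> K2 \<Longrightarrow> 0 \<le> x \<Longrightarrow>
    norm ((w + of_real x) powr (- s)) \<le> C * (1 + x) powr (- \<tau>)"
proof -
  obtain c where c: "c > 0" "\<And>w x. w \<in> K2 \<Longrightarrow> 0 \<le> x \<Longrightarrow> c * (1 + x) \<le> norm (w + of_real x)"
    using compact_slit_plane_lower_bound[OF assms(2,3)] by blast
  obtain R where R: "R > 0" "\<And>s. s \<in> K1 \<Longrightarrow> norm s \<le> R"
    using compact_imp_bounded[OF assms(1)] by (auto simp: bounded_pos)
  obtain Q' where Q': "Q' > 0" "\<And>w. w \<in> K2 \<Longrightarrow> norm w \<le> Q'"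
    using compact_imp_bounded[OF assms(2)] by (auto simp: bounded_pos)
  define Q where "Q = Q' + 1"
  define C where "C = exp (pi * R) * exp (R * (\<bar>ln c\<bar> + \<bar>ln Q\<bar>))"
  show thesis
  proof
    show "C \<ge> 0" by (simp add: C_def)
    fix s w :: complex and x :: real assume *: "s \<in> K1" "w \<in> K2" "0 \<le> x"
    define z where "z = w + of_real x"
    have lower: "c * (1 + x) \<le> norm z" unfolding z_def using c * by blast
    have "norm z \<le> Q' + x" unfolding z_def using norm_triangle_ineq[of w "of_real x"] Q'(2)[of w] * by simp
    also have "\<dots> \<le> Q * (1 + x)" using * Q' by (simp add: Q_def algebra_simps)
    finally have upper: "norm z \<le> Q * (1 + x)" .
    have z: "norm z > 0" using lower c * by (smt (verit) mult_pos_pos)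
    have s: "\<bar>Re s\<bar> \<le> R" "\<bar>Im s\<bar> \<le> R" using R(2)[of s] abs_Re_le_cmod[of s] abs_Im_le_cmod[of s] * by linarith+
    have "norm (z powr (-s)) \<le> exp (pi * \<bar>Im s\<bar>) * norm z powr (- Re s)"
      using norm_powr_bound[of z "-s"] z by simp
    also have "\<dots> \<le> exp (pi * R) * (exp (R * (\<bar>ln c\<bar> + \<bar>ln Q\<bar>)) * (1 + x) powr (- \<tau>))"
    proof (intro mult_mono)
      have "ln c + ln (1 + x) \<le> ln (norm z)" using lower c * z 
        by (subst ln_mult_pos[symmetric]) (auto intro!: ln_mono)
      moreover have "ln (norm z) \<le> ln Q + ln (1 + x)" using upper Q' * z 
        by (subst ln_mult_pos[symmetric]) (auto intro!: ln_mono simp: Q_def)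
      ultimately have "\<bar>ln (norm z) - ln (1 + x)\<bar> \<le> \<bar>ln c\<bar> + \<bar>ln Q\<bar>" by linarith
      hence "\<bar>Re s\<bar> * \<bar>ln (norm z) - ln (1 + x)\<bar> \<le> R * (\<bar>ln c\<bar> + \<bar>ln Q\<bar>)"
        using s by (intro mult_mono) auto
      hence "- Re s * (ln (norm z) - ln (1 + x)) \<le> R * (\<bar>ln c\<bar> + \<bar>ln Q\<bar>)"
        by (metis abs_ge_self abs_minus_cancel abs_mult order_trans)
      moreover have "\<tau> * ln (1 + x) \<le> Re s * ln (1 + x)" using * assms(4) by (intro mult_right_mono) auto
      ultimately have "- Re s * ln (norm z) \<le> R * (\<bar>ln c\<bar> + \<bar>ln Q\<bar>) - \<tau> * ln (1 + x)"
        by (simp add: algebra_simps)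
      hence "exp (- Re s * ln (norm z)) \<le> exp (R * (\<bar>ln c\<bar> + \<bar>ln Q\<bar>) + (- \<tau> * ln (1 + x)))" by simp
      thus "norm z powr (- Re s) \<le> exp (R * (\<bar>ln c\<bar> + \<bar>ln Q\<bar>)) * (1 + x) powr (- \<tau>)"
        using z * by (simp add: powr_def flip: exp_add)
    qed (use s in auto)
    finally show "norm ((w + of_real x) powr (- s)) \<le> C * (1 + x) powr (- \<tau>)"
      by (simp add: C_def z_def)
  qed
qed

section \<open>Convergence of sums over the lattice\<close>

lemma barnes_Omega_nonneg:
  assumes "\<forall>i\<in>{1..M}. a i > 0"
  shows "0 \<le> barnes_Omega M a n"
  unfolding barnes_Omega_def using assms by (intro sum_nonneg mult_nonneg_nonneg) (auto simp: less_imp_le)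

lemma countable_multi_indices: "countable (multi_indices M)"
  unfolding multi_indices_def by (intro countable_PiE) auto

text \<open>Since \<open>1 + \<Omega> \<ge> c (1 + n\<^sub>i)\<close> for each \<open>i\<close>, the series is dominated by a product of \<open>M\<close> one-dimensional ones.\<close>

lemma summable_barnes_Omega_powr:
  assumes a: "\<forall>i\<in>{1..M}. a i > 0" and \<tau>: "\<tau> > real M"
  shows "(\<lambda>n. (1 + barnes_Omega M a n) powr (- \<tau>)) summable_on multi_indices M"
proof (cases "M = 0")
  case True
  thus ?thesis by (simp add: multi_indices_def)
next
  case False
  \<comment> \<open>Including 1 in the minimum gives \<open>c \<le> 1\<close>, so that the constant
    term of \<open>c * (1 + n i)\<close> is absorbed by the 1 in
    \<open>1 + \<Omega>\<close>.\<close>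
  define c where "c = Min (insert 1 (a ` {1..M}))"
  have c: "c > 0" "c \<le> 1" using a by (auto simp: c_def)
  have c_le: "c \<le> a i" if "i \<in> {1..M}" for i
    unfolding c_def using that by (intro Min_le) auto
  \<comment> \<open>The exponent is shared equally among the \<open>M\<close> coordinates; each
    share exceeds 1, which is what the one-dimensional series needs.\<close>
  define p where "p = \<tau> / real M"
  have p: "p > 1" "p * real M = \<tau>" using \<tau> False by (auto simp: p_def field_simps)
  have "summable (\<lambda>k. (c * (1 + real k)) powr (- p))"
  proof -
    have "summable (\<lambda>k. real (Suc k) powr (- p))"
      using p by (subst summable_Suc_iff) (simp add: summable_real_powr_iff)
    hence "summable (\<lambda>k. c powr (- p) * real (Suc k) powr (- p))" by (rule summable_mult)
    thus ?thesis using c by (simp add: powr_mult add.commute)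
  qed
  hence "Infinite_Set_Sum.abs_summable_on (\<lambda>k. (c * (1 + real k)) powr (- p)) (UNIV :: nat set)"
    by (subst abs_summable_on_nat_iff') simp
  hence "Infinite_Set_Sum.abs_summable_on (\<lambda>n. \<Prod>i\<in>{1..M}. (c * (1 + real (n i))) powr (- p)) (multi_indices M)"
    unfolding multi_indices_def by (intro abs_summable_on_prod_PiE) auto
  hence "(\<lambda>n. norm (\<Prod>i\<in>{1..M}. (c * (1 + real (n i))) powr (- p))) summable_on multi_indices M"
    by (simp add: abs_summable_equivalent [symmetric])
  thus ?thesis
  proof (rule summable_on_comparison_test)
    fix n
    define W where "W = 1 + barnes_Omega M a n"
    have W: "W > 0" using barnes_Omega_nonneg[OF a, of n] by (simp add: W_def)
    have "c * (1 + real (n i)) \<le> W" if "i \<in> {1..M}" for i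
    proof -
      have "c * (1 + real (n i)) \<le> 1 + real (n i) * a i"
        using c(2) mult_left_mono[OF c_le[OF that], of "real (n i)"] by (simp add: algebra_simps)
      moreover have "real (n i) * a i \<le> barnes_Omega M a n" unfolding barnes_Omega_def
        using a that by (intro member_le_sum mult_nonneg_nonneg) (auto simp: less_imp_le)
      ultimately show ?thesis by (simp add: W_def)
    qed
    hence "(\<Prod>i\<in>{1..M}. W powr (- p)) \<le> (\<Prod>i\<in>{1..M}. (c * (1 + real (n i))) powr (- p))"
      using c p by (intro prod_mono) (auto intro!: powr_mono2')
    also have "(\<Prod>i\<in>{1..M}. W powr (- p)) = W powr (- \<tau>)"
      using W p by (simp add: powr_powr flip: powr_realpow)
    finally show "W powr (- \<tau>) \<le> norm (\<Prod>i\<in>{1..M}. (c * (1 + real (n i))) powr (- p))"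
      by (smt (verit) real_norm_def)
  qed auto
qed

section \<open>Lattice series as holomorphic functions of \<open>s\<close> and
  \<open>w\<close>\<close>

text \<open>The Weierstrass test for the net of finite subsets gives uniform convergence on closed
  discs, without enumerating the index set. The second claim, termwise differentiation, is what
  turns the series into logarithms at \<open>s = 0\<close>.\<close>

lemma infsum_holomorphic:
  fixes f :: "'a \<Rightarrow> complex \<Rightarrow> complex"
  assumes S: "open S" and f: "\<And>n. n \<in> A \<Longrightarrow> f n holomorphic_on S"
    and bound: "\<And>K. compact K \<Longrightarrow> K \<subseteq> S \<Longrightarrow>
                  \<exists>g. g summable_on A \<and> (\<forall>n\<in>A. \<forall>z\<in>K. norm (f n z) \<le> g n)"
  shows "(\<lambda>z. \<Sum>\<^sub>\<infinity>n\<in>A. f n z) holomorphic_on S"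
    and "z \<in> S \<Longrightarrow> ((\<lambda>F. \<Sum>n\<in>F. deriv (f n) z) \<longlongrightarrow> deriv (\<lambda>z. \<Sum>\<^sub>\<infinity>n\<in>A. f n z) z)
           (finite_subsets_at_top A)"
proof -
  have *: "((\<lambda>z. \<Sum>\<^sub>\<infinity>n\<in>A. f n z) has_field_derivative deriv (\<lambda>z. \<Sum>\<^sub>\<infinity>n\<in>A. f n z) z) (at z) \<and>
     ((\<lambda>F. \<Sum>n\<in>F. deriv (f n) z) \<longlongrightarrow> deriv (\<lambda>z. \<Sum>\<^sub>\<infinity>n\<in>A. f n z) z) (finite_subsets_at_top A)"
    if z: "z \<in> S" for z
  proof -
    obtain r where r: "r > 0" "cball z r \<subseteq> S" using S z open_contains_cball by blast
    obtain g where g: "g summable_on A" "\<And>n z'. n \<in> A \<Longrightarrow> z' \<in> cball z r \<Longrightarrow> norm (f n z') \<le> g n"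
      using bound[of "cball z r"] r by auto
    have ul: "uniform_limit (cball z r) (\<lambda>F z. \<Sum>n\<in>F. f n z) (\<lambda>z. \<Sum>\<^sub>\<infinity>n\<in>A. f n z) (finite_subsets_at_top A)"
      by (rule Weierstrass_m_test_general[OF g(2,1)])
    have ev: "eventually (\<lambda>F. continuous_on (cball z r) (\<lambda>z. \<Sum>n\<in>F. f n z) \<and>
            (\<forall>w\<in>ball z r. ((\<lambda>z. \<Sum>n\<in>F. f n z) has_field_derivative (\<Sum>n\<in>F. deriv (f n) w)) (at w)))
          (finite_subsets_at_top A)"
      unfolding eventually_finite_subsets_at_top
    proof (rule exI[of _ "{}"], safe)
      fix F assume F: "finite F" "F \<subseteq> A"
      have "(\<lambda>z. \<Sum>n\<in>F. f n z) holomorphic_on S" using F f by (intro holomorphic_intros) auto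
      thus "continuous_on (cball z r) (\<lambda>z. \<Sum>n\<in>F. f n z)"
        using r holomorphic_on_imp_continuous_on holomorphic_on_subset by blast
      fix w assume w: "w \<in> ball z r"
      hence "w \<in> S" using r by auto
      thus "((\<lambda>z. \<Sum>n\<in>F. f n z) has_field_derivative (\<Sum>n\<in>F. deriv (f n) w)) (at w)"
        using F f S by (intro DERIV_sum holomorphic_derivI[of _ S]) auto
    qed
    obtain g' where g': "((\<lambda>z. \<Sum>\<^sub>\<infinity>n\<in>A. f n z) has_field_derivative g' z) (at z)"
       "((\<lambda>F. \<Sum>n\<in>F. deriv (f n) z) \<longlongrightarrow> g' z) (finite_subsets_at_top A)"
    proof (rule has_complex_derivative_uniform_limit[OF ev ul _ r(1)])
      fix g' assume "\<And>w. w \<in> ball z r \<Longrightarrow> ((\<lambda>z. \<Sum>\<^sub>\<infinity>n\<in>A. f n z) has_field_derivative g' w) (at w) \<and>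
          ((\<lambda>F. \<Sum>n\<in>F. deriv (f n) w) \<longlongrightarrow> g' w) (finite_subsets_at_top A)"
      thus thesis using that r(1) by (meson centre_in_ball)
    qed auto
    moreover have "deriv (\<lambda>z. \<Sum>\<^sub>\<infinity>n\<in>A. f n z) z = g' z" using g'(1) by (rule DERIV_imp_deriv)
    ultimately show ?thesis by simp
  qed
  show "(\<lambda>z. \<Sum>\<^sub>\<infinity>n\<in>A. f n z) holomorphic_on S" using * S by (auto simp: holomorphic_on_open)
  show "z \<in> S \<Longrightarrow> ((\<lambda>F. \<Sum>n\<in>F. deriv (f n) z) \<longlongrightarrow> deriv (\<lambda>z. \<Sum>\<^sub>\<infinity>n\<in>A. f n z) z)
           (finite_subsets_at_top A)" using * by blast
qed

text \<open>By Osgood's lemma this amounts to joint holomorphy on \<open>{s. Re s > \<sigma>} \<times> slit_plane\<close>.\<close>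

definition sep_holo :: "real \<Rightarrow> (complex \<Rightarrow> complex \<Rightarrow> complex) \<Rightarrow> bool" where
  "sep_holo \<sigma> F \<longleftrightarrow>
     (\<forall>w\<in>slit_plane. (\<lambda>s. F s w) holomorphic_on {s. Re s > \<sigma>}) \<and>
     (\<forall>s. Re s > \<sigma> \<longrightarrow> F s holomorphic_on slit_plane) \<and>
     (\<forall>K1 K2. compact K1 \<longrightarrow> compact K2 \<longrightarrow> K1 \<subseteq> {s. Re s > \<sigma>} \<longrightarrow> K2 \<subseteq> slit_plane \<longrightarrow>
        (\<exists>B. \<forall>s\<in>K1. \<forall>w\<in>K2. norm (F s w) \<le> B))"

lemma sep_holoD:
  assumes "sep_holo \<sigma> F"
  shows "w \<in> slit_plane \<Longrightarrow> (\<lambda>s. F s w) holomorphic_on {s. Re s > \<sigma>}"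
    and "Re s > \<sigma> \<Longrightarrow> F s holomorphic_on slit_plane"
    and "compact K1 \<Longrightarrow> compact K2 \<Longrightarrow> K1 \<subseteq> {s. Re s > \<sigma>} \<Longrightarrow> K2 \<subseteq> slit_plane \<Longrightarrow>
           \<exists>B\<ge>0. \<forall>s\<in>K1. \<forall>w\<in>K2. norm (F s w) \<le> B"
proof -
  assume "compact K1" "compact K2" "K1 \<subseteq> {s. Re s > \<sigma>}" "K2 \<subseteq> slit_plane"
  then obtain B where "\<forall>s\<in>K1. \<forall>w\<in>K2. norm (F s w) \<le> B"
    using assms unfolding sep_holo_def by blast
  hence "\<forall>s\<in>K1. \<forall>w\<in>K2. norm (F s w) \<le> max 0 B" by fastforce
  thus "\<exists>B\<ge>0. \<forall>s\<in>K1. \<forall>w\<in>K2. norm (F s w) \<le> B" by (intro exI[of _ "max 0 B"]) auto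
qed (use assms in \<open>unfold sep_holo_def, blast+\<close>)

lemma sep_holo_mono:
  assumes "sep_holo \<sigma> F" "\<sigma> \<le> \<sigma>'"
  shows "sep_holo \<sigma>' F"
  unfolding sep_holo_def
proof (intro conjI ballI allI impI)
  have *: "{s. Re s > \<sigma>'} \<subseteq> {s. Re s > \<sigma>}" using assms(2) by auto
  show "(\<lambda>s. F s w) holomorphic_on {s. Re s > \<sigma>'}" if "w \<in> slit_plane" for w
    using sep_holoD(1)[OF assms(1) that] * by (rule holomorphic_on_subset)
  show "F s holomorphic_on slit_plane" if "Re s > \<sigma>'" for s
    using that assms(2) by (intro sep_holoD(2)[OF assms(1)]) auto
  fix K1 K2 :: "complex set"
  assume "compact K1" "compact K2" "K1 \<subseteq> {s. Re s > \<sigma>'}" "K2 \<subseteq> slit_plane"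
  thus "\<exists>B. \<forall>s\<in>K1. \<forall>w\<in>K2. norm (F s w) \<le> B"
    using sep_holoD(3)[OF assms(1), of K1 K2] * by blast
qed

lemma sep_holo_cong:
  assumes "\<And>s w. Re s > \<sigma> \<Longrightarrow> w \<in> slit_plane \<Longrightarrow> F s w = G s w"
  shows "sep_holo \<sigma> F \<longleftrightarrow> sep_holo \<sigma> G"
proof -
  have "sep_holo \<sigma> G" if F: "sep_holo \<sigma> F" and eq: "\<And>s w. Re s > \<sigma> \<Longrightarrow> w \<in> slit_plane \<Longrightarrow> F s w = G s w" for F G
    unfolding sep_holo_def
  proof (intro conjI ballI allI impI)
    show "(\<lambda>s. G s w) holomorphic_on {s. Re s > \<sigma>}" if "w \<in> slit_plane" for w
      using sep_holoD(1)[OF F that] by (rule holomorphic_transform) (use eq that in auto)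
    show "G s holomorphic_on slit_plane" if "Re s > \<sigma>" for s
      using sep_holoD(2)[OF F that] by (rule holomorphic_transform) (use eq that in auto)
    fix K1 K2 :: "complex set"
    assume *: "compact K1" "compact K2" "K1 \<subseteq> {s. Re s > \<sigma>}" "K2 \<subseteq> slit_plane"
    then obtain B where "\<forall>s\<in>K1. \<forall>w\<in>K2. norm (F s w) \<le> B" using sep_holoD(3)[OF F] by blast
    hence "\<forall>s\<in>K1. \<forall>w\<in>K2. norm (G s w) \<le> B" using * eq by (smt (verit, best) mem_Collect_eq subsetD)
    thus "\<exists>B. \<forall>s\<in>K1. \<forall>w\<in>K2. norm (G s w) \<le> B" by blast
  qed
  from this[of F G] this[of G F] assms show ?thesis by metis
qed

lemma sep_holo_add:
  assumes "sep_holo \<sigma> F" "sep_holo \<sigma> G"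
  shows "sep_holo \<sigma> (\<lambda>s w. F s w + G s w)"
  unfolding sep_holo_def
proof (intro conjI ballI allI impI)
  fix K1 K2 :: "complex set"
  assume *: "compact K1" "compact K2" "K1 \<subseteq> {s. Re s > \<sigma>}" "K2 \<subseteq> slit_plane"
  then obtain B1 B2 where "\<forall>s\<in>K1. \<forall>w\<in>K2. norm (F s w) \<le> B1" "\<forall>s\<in>K1. \<forall>w\<in>K2. norm (G s w) \<le> B2"
    using sep_holoD(3)[OF assms(1)] sep_holoD(3)[OF assms(2)] by meson
  thus "\<exists>B. \<forall>s\<in>K1. \<forall>w\<in>K2. norm (F s w + G s w) \<le> B"
    by (intro exI[of _ "B1 + B2"]) (meson add_mono norm_triangle_le)
qed (use assms in \<open>auto intro!: holomorphic_intros dest: sep_holoD\<close>)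

lemma sep_holo_mult:
  assumes "c holomorphic_on {s. Re s > \<sigma>}" "sep_holo \<sigma> F"
  shows "sep_holo \<sigma> (\<lambda>s w. c s * F s w)"
  unfolding sep_holo_def
proof (intro conjI ballI allI impI)
  fix K1 K2 :: "complex set"
  assume *: "compact K1" "compact K2" "K1 \<subseteq> {s. Re s > \<sigma>}" "K2 \<subseteq> slit_plane"
  have "continuous_on K1 c" using * assms(1)
    by (meson holomorphic_on_imp_continuous_on holomorphic_on_subset)
  then obtain B1 where "B1 > 0" "\<And>s. s \<in> K1 \<Longrightarrow> norm (c s) \<le> B1"
    using compact_continuous_bound[OF *(1)] by blast
  moreover obtain B2 where "\<forall>s\<in>K1. \<forall>w\<in>K2. norm (F s w) \<le> B2"
    using sep_holoD(3)[OF assms(2)] * by meson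
  ultimately show "\<exists>B. \<forall>s\<in>K1. \<forall>w\<in>K2. norm (c s * F s w) \<le> B"
    by (intro exI[of _ "B1 * B2"]) (auto simp: norm_mult intro!: mult_mono)
qed (use assms in \<open>auto intro!: holomorphic_intros dest: sep_holoD\<close>)

lemma sep_holo_sum:
  assumes "\<And>k. k \<in> I \<Longrightarrow> sep_holo \<sigma> (F k)"
  shows "sep_holo \<sigma> (\<lambda>s w. \<Sum>k\<in>I. F k s w)"
  using assms
proof (induction I rule: infinite_finite_induct)
  case (insert x I)
  thus ?case by (simp add: sep_holo_add)
qed (auto simp: sep_holo_def intro!: exI[of _ 0])

lemma sep_holo_shift:
  assumes "sep_holo \<sigma> F" "\<sigma> \<le> \<sigma>' + Re c"
  shows "sep_holo \<sigma>' (\<lambda>s w. F (s + c) w)"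
  unfolding sep_holo_def
proof (intro conjI ballI allI impI)
  show "(\<lambda>s. F (s + c) w) holomorphic_on {s. Re s > \<sigma>'}" if "w \<in> slit_plane" for w
  proof -
    have "(\<lambda>s. F s w) \<circ> (\<lambda>s. s + c) holomorphic_on {s. Re s > \<sigma>'}"
      by (rule holomorphic_on_compose_gen[OF _ sep_holoD(1)[OF assms(1) that]])
         (use assms(2) in \<open>auto intro!: holomorphic_intros\<close>)
    thus ?thesis by (simp add: o_def)
  qed
  show "F (s + c) holomorphic_on slit_plane" if "Re s > \<sigma>'" for s
    using assms that by (intro sep_holoD(2)) auto
  fix K1 K2 :: "complex set"
  assume *: "compact K1" "compact K2" "K1 \<subseteq> {s. Re s > \<sigma>'}" "K2 \<subseteq> slit_plane"
  have "compact ((\<lambda>s. s + c) ` K1)" using * by (intro compact_continuous_image continuous_intros)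
  moreover have "(\<lambda>s. s + c) ` K1 \<subseteq> {s. Re s > \<sigma>}" using * assms(2) by force
  ultimately show "\<exists>B. \<forall>s\<in>K1. \<forall>w\<in>K2. norm (F (s + c) w) \<le> B"
    using sep_holoD(3)[OF assms(1)] * by (metis image_eqI)
qed

text \<open>The exponent \<open>\<tau>\<close> may depend on the compact sets: in the applications
  the decay becomes critical at the edge of the half-plane, and only on a compact \<open>K1\<close>
  is \<open>Re s\<close> bounded away from it.\<close>

lemma sep_holo_lattice_sum:
  assumes a: "\<forall>i\<in>{1..M}. a i > 0"
    and hol1: "\<And>w. w \<in> slit_plane \<Longrightarrow> (\<lambda>s. \<Phi> s w) holomorphic_on {s. Re s > \<sigma>}"
    and hol2: "\<And>s. Re s > \<sigma> \<Longrightarrow> \<Phi> s holomorphic_on slit_plane"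
    and bound: "\<And>K1 K2. compact K1 \<Longrightarrow> compact K2 \<Longrightarrow> K1 \<subseteq> {s. Re s > \<sigma>} \<Longrightarrow> K2 \<subseteq> slit_plane \<Longrightarrow>
       \<exists>C \<tau>. \<tau> > real M \<and> (\<forall>s\<in>K1. \<forall>w\<in>K2. \<forall>x\<ge>0. norm (\<Phi> s (w + of_real x)) \<le> C * (1 + x) powr (- \<tau>))"
  shows "sep_holo \<sigma> (\<lambda>s w. \<Sum>\<^sub>\<infinity>n\<in>multi_indices M. \<Phi> s (w + of_real (barnes_Omega M a n)))"
proof -
  note nonneg = barnes_Omega_nonneg[OF a]
  have dom: "\<exists>g. g summable_on multi_indices M \<and>
      (\<forall>n\<in>multi_indices M. \<forall>s\<in>K1. \<forall>w\<in>K2. norm (\<Phi> s (w + of_real (barnes_Omega M a n))) \<le> g n)"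
    if K: "compact K1" "compact K2" "K1 \<subseteq> {s. Re s > \<sigma>}" "K2 \<subseteq> slit_plane" for K1 K2
  proof -
    obtain C \<tau> where *: "\<tau> > real M"
      "\<forall>s\<in>K1. \<forall>w\<in>K2. \<forall>x\<ge>0. norm (\<Phi> s (w + of_real x)) \<le> C * (1 + x) powr (- \<tau>)"
      using bound[OF K] by blast
    have "(\<lambda>n. C * (1 + barnes_Omega M a n) powr (- \<tau>)) summable_on multi_indices M"
      by (intro summable_on_cmult_right summable_barnes_Omega_powr a *)
    thus ?thesis using * nonneg by blast
  qed
  have 1: "(\<lambda>s. \<Sum>\<^sub>\<infinity>n\<in>multi_indices M. \<Phi> s (w + of_real (barnes_Omega M a n))) holomorphic_on {s. Re s > \<sigma>}"
    if w: "w \<in> slit_plane" for w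
  proof (rule infsum_holomorphic(1))
    show "open {s. Re s > \<sigma>}" by (rule open_halfspace_Re_gt)
    show "(\<lambda>s. \<Phi> s (w + of_real (barnes_Omega M a n))) holomorphic_on {s. Re s > \<sigma>}" for n
      using w slit_plane_add nonneg by (intro hol1) auto
    fix K assume "compact K" "K \<subseteq> {s. Re s > \<sigma>}"
    thus "\<exists>g. g summable_on multi_indices M \<and>
       (\<forall>n\<in>multi_indices M. \<forall>s\<in>K. norm (\<Phi> s (w + of_real (barnes_Omega M a n))) \<le> g n)"
      using dom[of K "{w}"] w by simp
  qed
  have 2: "(\<lambda>w. \<Sum>\<^sub>\<infinity>n\<in>multi_indices M. \<Phi> s (w + of_real (barnes_Omega M a n))) holomorphic_on slit_plane"
    if s: "Re s > \<sigma>" for s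
  proof (rule infsum_holomorphic(1))
    show "open slit_plane" by (rule open_slit_plane)
    show "(\<lambda>w. \<Phi> s (w + of_real (barnes_Omega M a n))) holomorphic_on slit_plane" for n
    proof -
      have "\<Phi> s \<circ> (\<lambda>w. w + of_real (barnes_Omega M a n)) holomorphic_on slit_plane"
        by (rule holomorphic_on_compose_gen[OF _ hol2[OF s]])
           (use slit_plane_add nonneg in \<open>auto intro!: holomorphic_intros\<close>)
      thus ?thesis by (simp add: o_def)
    qed
    fix K assume "compact K" "K \<subseteq> slit_plane"
    thus "\<exists>g. g summable_on multi_indices M \<and>
       (\<forall>n\<in>multi_indices M. \<forall>w\<in>K. norm (\<Phi> s (w + of_real (barnes_Omega M a n))) \<le> g n)"
      using dom[of "{s}" K] s by simp
  qed
  have 3: "\<exists>B. \<forall>s\<in>K1. \<forall>w\<in>K2. norm (\<Sum>\<^sub>\<infinity>n\<in>multi_indices M. \<Phi> s (w + of_real (barnes_Omega M a n))) \<le> B"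
    if K: "compact K1" "compact K2" "K1 \<subseteq> {s. Re s > \<sigma>}" "K2 \<subseteq> slit_plane" for K1 K2
  proof -
    obtain g where g: "g summable_on multi_indices M"
      "\<And>n s w. n \<in> multi_indices M \<Longrightarrow> s \<in> K1 \<Longrightarrow> w \<in> K2 \<Longrightarrow> norm (\<Phi> s (w + of_real (barnes_Omega M a n))) \<le> g n"
      using dom[OF K] by blast
    have "norm (\<Sum>\<^sub>\<infinity>n\<in>multi_indices M. \<Phi> s (w + of_real (barnes_Omega M a n))) \<le> infsum g (multi_indices M)"
      if "s \<in> K1" "w \<in> K2" for s w
    proof (rule norm_infsum_le[OF has_sum_infsum has_sum_infsum])
      have "(\<lambda>n. norm (\<Phi> s (w + of_real (barnes_Omega M a n)))) summable_on multi_indices M"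
        by (rule summable_on_comparison_test[OF g(1)]) (use g that in auto)
      thus "(\<lambda>n. \<Phi> s (w + of_real (barnes_Omega M a n))) summable_on multi_indices M"
        by (rule abs_summable_summable)
    qed (use g that in auto)
    thus ?thesis by blast
  qed
  show ?thesis unfolding sep_holo_def using 1 2 3 by auto
qed

subsection \<open>Lattice sums of powers\<close>

text \<open>The \<open>i\<close>-th derivative of \<open>z powr (- s)\<close> in \<open>z\<close>.
  The closed form keeps the dependence on \<open>s\<close> visible, and summing it over the lattice
  gives a multiple of \<open>\<zeta>\<^sub>M(s + i, w)\<close>.\<close>

definition powr_deriv :: "complex \<Rightarrow> nat \<Rightarrow> complex \<Rightarrow> complex" where
  "powr_deriv s i z = (-1) ^ i * pochhammer s i * z powr (- (s + of_nat i))"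

lemma powr_deriv_0 [simp]: "powr_deriv s 0 z = z powr (- s)"
  by (simp add: powr_deriv_def)

lemma has_field_derivative_powr_deriv:
  assumes "z \<in> slit_plane"
  shows "(powr_deriv s i has_field_derivative powr_deriv s (Suc i) z) (at z)"
proof -
  have "((\<lambda>z. z powr (- (s + of_nat i))) has_field_derivative
          - (s + of_nat i) * z powr (- (s + of_nat i) - 1)) (at z)"
    using assms by (intro has_field_derivative_powr) auto
  hence "((\<lambda>z. (-1) ^ i * pochhammer s i * z powr (- (s + of_nat i))) has_field_derivative
          (-1) ^ i * pochhammer s i * (- (s + of_nat i) * z powr (- (s + of_nat i) - 1))) (at z)"
    by (rule DERIV_cmult)
  moreover have "- (s + of_nat i) - 1 = - (s + of_nat (Suc i))" by simp
  moreover have "(-1) ^ i * pochhammer s i * (- (s + of_nat i) * y) = (-1) ^ Suc i * pochhammer s (Suc i) * y" for y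
    by (simp add: pochhammer_Suc algebra_simps)
  ultimately show ?thesis unfolding powr_deriv_def by metis
qed

lemma powr_deriv_shift_bound:
  assumes "compact K1" "compact K2" "K2 \<subseteq> slit_plane" "\<And>s. s \<in> K1 \<Longrightarrow> \<tau> \<le> Re s"
  obtains C where "C \<ge> 0" "\<And>s w x. s \<in> K1 \<Longrightarrow> w \<in> K2 \<Longrightarrow> 0 \<le> x \<Longrightarrow>
    norm (powr_deriv s i (w + of_real x)) \<le> C * (1 + x) powr (- (\<tau> + real i))"
proof -
  have "compact ((\<lambda>s. s + of_nat i) ` K1)" using assms(1) by (intro compact_continuous_image continuous_intros)
  then obtain C1 where C1: "C1 \<ge> 0" "\<And>s w x. s \<in> (\<lambda>s. s + of_nat i) ` K1 \<Longrightarrow> w \<in> K2 \<Longrightarrow> 0 \<le> x \<Longrightarrow>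
    norm ((w + of_real x) powr (- s)) \<le> C1 * (1 + x) powr (- (\<tau> + real i))"
    by (rule powr_shift_bound[OF _ assms(2,3), of _ "\<tau> + real i"]) (use assms(4) in auto)
  have "continuous_on K1 (\<lambda>s. pochhammer s i)"
    by (auto simp: pochhammer_prod intro!: continuous_intros)
  then obtain C2 where C2: "C2 > 0" "\<And>s. s \<in> K1 \<Longrightarrow> norm (pochhammer s i) \<le> C2"
    using compact_continuous_bound[OF assms(1)] by blast
  show thesis
  proof
    show "C2 * C1 \<ge> 0" using C1 C2 by simp
    fix s w :: complex and x :: real assume *: "s \<in> K1" "w \<in> K2" "0 \<le> x"
    have "norm (powr_deriv s i (w + of_real x)) = norm (pochhammer s i) * norm ((w + of_real x) powr (- (s + of_nat i)))"
      by (simp add: powr_deriv_def norm_mult norm_power)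
    also have "\<dots> \<le> C2 * (C1 * (1 + x) powr (- (\<tau> + real i)))"
      using C1(2)[of "s + of_nat i" w x] C2 * by (intro mult_mono) auto
    finally show "norm (powr_deriv s i (w + of_real x)) \<le> C2 * C1 * (1 + x) powr (- (\<tau> + real i))"
      by (simp add: mult.assoc)
  qed
qed

lemma powr_deriv_holomorphic:
  shows "z \<in> slit_plane \<Longrightarrow> (\<lambda>s. powr_deriv s i z) holomorphic_on S"
    and "powr_deriv s i holomorphic_on slit_plane"
proof -
  show "(\<lambda>s. powr_deriv s i z) holomorphic_on S" if "z \<in> slit_plane"
  proof -
    have "z \<noteq> 0" using that by auto
    thus ?thesis unfolding powr_deriv_def pochhammer_prod powr_def by (auto intro!: holomorphic_intros)
  qed
  show "powr_deriv s i holomorphic_on slit_plane"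
    using has_field_derivative_powr_deriv open_slit_plane by (auto simp: holomorphic_on_open)
qed

lemma summable_powr_deriv:
  assumes "\<forall>i\<in>{1..M}. a i > 0" "Re s > real M" "w \<in> slit_plane"
  shows "(\<lambda>n. powr_deriv s i (w + of_real (barnes_Omega M a n))) summable_on multi_indices M"
proof -
  obtain C where C: "C \<ge> 0" "\<And>s' w' x. s' \<in> {s} \<Longrightarrow> w' \<in> {w} \<Longrightarrow> 0 \<le> x \<Longrightarrow>
    norm (powr_deriv s' i (w' + of_real x)) \<le> C * (1 + x) powr (- (Re s + real i))"
    by (rule powr_deriv_shift_bound[of "{s}" "{w}" "Re s" i]) (use assms in auto)
  have "(\<lambda>n. norm (powr_deriv s i (w + of_real (barnes_Omega M a n)))) summable_on multi_indices M"
  proof (rule summable_on_comparison_test)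
    show "(\<lambda>n. C * (1 + barnes_Omega M a n) powr (- (Re s + real i))) summable_on multi_indices M"
      using assms by (intro summable_on_cmult_right summable_barnes_Omega_powr) auto
  qed (use C barnes_Omega_nonneg[OF assms(1)] in auto)
  thus ?thesis by (rule abs_summable_summable)
qed

lemma sep_holo_barnes_zeta_series:
  assumes "\<forall>i\<in>{1..M}. a i > 0"
  shows "sep_holo (real M) (barnes_zeta_series M a)"
proof -
  have "sep_holo (real M) (\<lambda>s w. \<Sum>\<^sub>\<infinity>n\<in>multi_indices M. powr_deriv s 0 (w + of_real (barnes_Omega M a n)))"
  proof (rule sep_holo_lattice_sum[OF assms])
    fix K1 K2 :: "complex set"
    assume K: "compact K1" "compact K2" "K1 \<subseteq> {s. real M < Re s}" "K2 \<subseteq> slit_plane"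
    obtain \<tau> where \<tau>: "\<tau> > real M" "\<And>s. s \<in> K1 \<Longrightarrow> \<tau> \<le> Re s"
    proof (cases "K1 = {}")
      case False
      have "continuous_on K1 Re" by (intro continuous_intros)
      then obtain s0 where "s0 \<in> K1" "\<And>s. s \<in> K1 \<Longrightarrow> Re s0 \<le> Re s"
        using continuous_attains_inf[OF K(1) False] by blast
      thus ?thesis using that[of "Re s0"] K by auto
    qed (use that[of "real M + 1"] in auto)
    show "\<exists>C \<tau>. real M < \<tau> \<and> (\<forall>s\<in>K1. \<forall>w\<in>K2. \<forall>x\<ge>0. norm (powr_deriv s 0 (w + of_real x)) \<le> C * (1 + x) powr - \<tau>)"
      using powr_deriv_shift_bound[OF K(1,2,4) \<tau>(2), of 0] \<tau>(1) by (metis add.right_neutral of_nat_0)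
  qed (intro powr_deriv_holomorphic; simp)+
  thus ?thesis by (simp add: barnes_zeta_series_def [abs_def])
qed

subsection \<open>Analytic continuation in $s$\<close>

definition taylor_rem :: "nat \<Rightarrow> real \<Rightarrow> complex \<Rightarrow> complex \<Rightarrow> complex" where
  "taylor_rem K c s z = powr_deriv s 0 (z + of_real c) - (\<Sum>i\<le>K. powr_deriv s i z * of_real c ^ i / fact i)"

text \<open>Taylor's theorem bounds the remainder by the derivative of order \<open>K + 1\<close>,
  which decays \<open>K + 1\<close> powers faster than the summand itself. Raising \<open>K\<close>
  by one thus moves the region of convergence one unit to the left.\<close>

lemma sep_holo_taylor_rem_sum:
  assumes a: "\<forall>i\<in>{1..M}. a i > 0" and c: "c \<ge> 0" and \<sigma>: "\<sigma> + real (Suc K) \<ge> real M"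
  shows "sep_holo \<sigma> (\<lambda>s w. \<Sum>\<^sub>\<infinity>n\<in>multi_indices M. taylor_rem K c s (w + of_real (barnes_Omega M a n)))"
proof (rule sep_holo_lattice_sum[OF a])
  show "(\<lambda>s. taylor_rem K c s w) holomorphic_on {s. \<sigma> < Re s}" if "w \<in> slit_plane" for w
    unfolding taylor_rem_def using that slit_plane_add[OF that c]
    by (intro holomorphic_intros powr_deriv_holomorphic) auto
  show "taylor_rem K c s holomorphic_on slit_plane" for s
  proof -
    have "powr_deriv s 0 \<circ> (\<lambda>z. z + of_real c) holomorphic_on slit_plane"
      by (rule holomorphic_on_compose_gen[OF _ powr_deriv_holomorphic(2)])
         (use slit_plane_add c in \<open>auto intro!: holomorphic_intros\<close>)
    thus ?thesis unfolding taylor_rem_def [abs_def] o_def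
      by (intro holomorphic_intros powr_deriv_holomorphic(2)) auto
  qed
  fix K1 K2 :: "complex set"
  assume K: "compact K1" "compact K2" "K1 \<subseteq> {s. \<sigma> < Re s}" "K2 \<subseteq> slit_plane"
  \<comment> \<open>The intermediate points of Taylor's theorem are \<open>w + x + t\<close> with
    \<open>0 \<le> t \<le> c\<close>. Moving \<open>t\<close> into the compact set leaves a pure
    shift by \<open>x\<close>, to which the uniform bound applies.\<close>
  define K2' where "K2' = (\<lambda>(w, x). w + complex_of_real x) ` (K2 \<times> {0..c})"
  have K2': "compact K2'" "K2' \<subseteq> slit_plane" unfolding K2'_def
    using compact_add_reals[OF K(2)] add_reals_subset_slit_plane[OF K(4)] by auto
  obtain \<tau> where \<tau>: "\<tau> > \<sigma>" "\<And>s. s \<in> K1 \<Longrightarrow> \<tau> \<le> Re s"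
  proof (cases "K1 = {}")
    case False
    have "continuous_on K1 Re" by (intro continuous_intros)
    then obtain s0 where "s0 \<in> K1" "\<And>s. s \<in> K1 \<Longrightarrow> Re s0 \<le> Re s"
      using continuous_attains_inf[OF K(1) False] by blast
    thus ?thesis using that[of "Re s0"] K by auto
  qed (use that[of "\<sigma> + 1"] in auto)
  obtain C where C: "C \<ge> 0" "\<And>s w x. s \<in> K1 \<Longrightarrow> w \<in> K2' \<Longrightarrow> 0 \<le> x \<Longrightarrow>
    norm (powr_deriv s (Suc K) (w + of_real x)) \<le> C * (1 + x) powr (- (\<tau> + real (Suc K)))"
    using powr_deriv_shift_bound[OF K(1) K2' \<tau>(2), of "Suc K"] by blast
  have "norm (taylor_rem K c s (w + of_real x)) \<le> (C * c ^ Suc K / fact K) * (1 + x) powr (- (\<tau> + real (Suc K)))"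
    if s: "s \<in> K1" and w: "w \<in> K2" and x: "x \<ge> 0" for s w x
  proof -
    define z where "z = w + of_real x"
    define S where "S = (\<lambda>t. z + of_real t) ` {0..c}"
    have S_slit: "S \<subseteq> slit_plane"
    proof
      fix y assume "y \<in> S"
      then obtain t where "t \<in> {0..c}" "y = w + of_real x + of_real t" by (auto simp: S_def z_def)
      thus "y \<in> slit_plane" using w x K(4) slit_plane_add by (metis atLeastAtMost_iff subsetD)
    qed
    have "convex S" unfolding S_def
      by (rule convex_translation[of "of_real ` {0..c}" z, unfolded image_image]) 
         (auto intro!: convex_linear_image linear_of_real)
    hence "cmod (powr_deriv s 0 (z + of_real c) - (\<Sum>i\<le>K. powr_deriv s i z * ((z + of_real c) - z) ^ i / fact i))
        \<le> C * (1 + x) powr (- (\<tau> + real (Suc K))) * cmod ((z + of_real c) - z) ^ Suc K / fact K"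
    proof (rule complex_Taylor)
      show "(powr_deriv s i has_field_derivative powr_deriv s (Suc i) y) (at y within S)" if "y \<in> S" for i y
        using that S_slit has_field_derivative_powr_deriv DERIV_subset has_field_derivative_at_within by blast
      show "cmod (powr_deriv s (Suc K) y) \<le> C * (1 + x) powr (- (\<tau> + real (Suc K)))" if y: "y \<in> S" for y
      proof -
        obtain t where t: "t \<in> {0..c}" "y = z + of_real t" using y unfolding S_def by auto
        have "y = (w + of_real t) + of_real x" by (simp add: t z_def)
        moreover have "w + of_real t \<in> K2'" unfolding K2'_def using t w by force
        ultimately show ?thesis using C(2)[OF s _ x] by metis
      qed
      show "z \<in> S" unfolding S_def using c by (auto intro!: image_eqI[of _ _ 0])
      show "z + of_real c \<in> S" unfolding S_def using c by (auto intro!: image_eqI[of _ _ c])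
    qed
    thus ?thesis using c unfolding taylor_rem_def z_def by (simp add: norm_power mult_ac)
  qed
  moreover have "\<tau> + real (Suc K) > real M" using \<tau> \<sigma> by simp
  ultimately show "\<exists>C \<tau>. real M < \<tau> \<and> (\<forall>s\<in>K1. \<forall>w\<in>K2. \<forall>x\<ge>0. norm (taylor_rem K c s (w + of_real x)) \<le> C * (1 + x) powr - \<tau>)"
    by blast
qed

lemma barnes_Omega_Suc: "barnes_Omega (Suc M) a n = barnes_Omega M a n + real (n (Suc M)) * a (Suc M)"
  by (simp add: barnes_Omega_def)

lemma barnes_Omega_upd [simp]: "barnes_Omega M a (n(Suc M := x)) = barnes_Omega M a n"
  by (simp add: barnes_Omega_def)

lemma multi_indices_0 [simp]: "multi_indices 0 = {\<lambda>_. undefined}"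
  by (simp add: multi_indices_def)

lemma mem_multi_indices_iff: "n \<in> multi_indices M \<longleftrightarrow> (\<forall>i. i \<notin> {1..M} \<longrightarrow> n i = undefined)"
  by (auto simp: multi_indices_def PiE_def extensional_def)

text \<open>The lattice points with last coordinate 0 form the lattice of dimension
  \<open>M\<close>; the others are a copy of the whole lattice translated by the last
  period.\<close>

lemma barnes_zeta_series_diff:
  assumes a: "\<forall>i\<in>{1..Suc M}. a i > 0" and s: "Re s > real (Suc M)" and w: "w \<in> slit_plane"
  shows "barnes_zeta_series (Suc M) a s w - barnes_zeta_series (Suc M) a s (w + of_real (a (Suc M)))
           = barnes_zeta_series M a s w"
proof -
  define A where "A = multi_indices (Suc M)"
  define A0 where "A0 = {n \<in> A. n (Suc M) = 0}"
  define A1 where "A1 = {n \<in> A. n (Suc M) \<noteq> 0}"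
  define f where "f = (\<lambda>n. (w + of_real (barnes_Omega (Suc M) a n)) powr (- s))"
  have sum: "f summable_on A" unfolding A_def f_def
    using summable_powr_deriv[OF a s w, of 0] by simp
  have A: "A = A0 \<union> A1" "A0 \<inter> A1 = {}" by (auto simp: A0_def A1_def)
  have "infsum f A = infsum f A0 + infsum f A1"
    unfolding A(1) using sum by (intro infsum_Un_disjoint A(2)) (auto intro: summable_on_subset_banach simp: A(1))
  \<comment> \<open>Dropping the last coordinate means resetting it to \<open>undefined\<close>, as
    multi-indices are extensional.\<close>
  also have "infsum f A0 = barnes_zeta_series M a s w"
    unfolding barnes_zeta_series_def
    by (rule infsum_reindex_bij_witness[where i = "\<lambda>n. n(Suc M := 0)" and j = "\<lambda>n. n(Suc M := undefined)"])
       (auto simp: A0_def A_def mem_multi_indices_iff f_def barnes_Omega_Suc fun_eq_iff)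
  also have "infsum f A1 = barnes_zeta_series (Suc M) a s (w + of_real (a (Suc M)))"
    unfolding barnes_zeta_series_def
    by (rule infsum_reindex_bij_witness[where i = "\<lambda>n. n(Suc M := Suc (n (Suc M)))"
            and j = "\<lambda>n. n(Suc M := n (Suc M) - 1)"])
       (auto simp: A1_def A_def mem_multi_indices_iff f_def barnes_Omega_Suc fun_eq_iff algebra_simps of_nat_diff)
  finally show ?thesis by (simp add: f_def A_def barnes_zeta_series_def)
qed

lemma has_sum_finite_sum:
  fixes f :: "'i \<Rightarrow> 'a \<Rightarrow> 'b::topological_comm_monoid_add"
  assumes "\<And>i. i \<in> I \<Longrightarrow> (f i has_sum S i) A"
  shows "((\<lambda>x. \<Sum>i\<in>I. f i x) has_sum (\<Sum>i\<in>I. S i)) A"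
  using assms by (induction I rule: infinite_finite_induct) (auto intro: has_sum_add has_sum_0)

lemma has_sum_powr_deriv:
  assumes "\<forall>i\<in>{1..M}. a i > 0" "Re s > real M" "w \<in> slit_plane"
  shows "((\<lambda>n. powr_deriv s i (w + of_real (barnes_Omega M a n))) has_sum
           (-1) ^ i * pochhammer s i * barnes_zeta_series M a (s + of_nat i) w) (multi_indices M)"
  using has_sum_infsum[OF summable_powr_deriv[OF assms, of i]]
  unfolding powr_deriv_def barnes_zeta_series_def infsum_cmult_right' .

text \<open>To the right of \<open>M\<close> the Taylor terms may be summed one at a time, because
  every argument \<open>s + i\<close> stays in the half-plane of convergence.\<close>

lemma taylor_rem_sum_eq:
  assumes a: "\<forall>i\<in>{1..M}. a i > 0" and s: "Re s > real M" and w: "w \<in> slit_plane" and c: "c \<ge> 0"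
  shows "(\<Sum>\<^sub>\<infinity>n\<in>multi_indices M. taylor_rem K c s (w + of_real (barnes_Omega M a n))) =
           barnes_zeta_series M a s (w + of_real c) -
           (\<Sum>i\<le>K. (-1) ^ i * pochhammer s i * of_real c ^ i / fact i * barnes_zeta_series M a (s + of_nat i) w)"
proof (rule infsumI)
  have "((\<lambda>n. powr_deriv s 0 (w + of_real c + of_real (barnes_Omega M a n))
            + (\<Sum>i\<le>K. - (of_real c ^ i / fact i) * powr_deriv s i (w + of_real (barnes_Omega M a n)))) has_sum
      (-1) ^ 0 * pochhammer s 0 * barnes_zeta_series M a (s + of_nat 0) (w + of_real c) +
      (\<Sum>i\<le>K. - (of_real c ^ i / fact i) * ((-1) ^ i * pochhammer s i * barnes_zeta_series M a (s + of_nat i) w)))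
      (multi_indices M)"
    by (intro has_sum_add has_sum_finite_sum has_sum_cmult_right has_sum_powr_deriv a s w slit_plane_add c)
  thus "((\<lambda>n. taylor_rem K c s (w + of_real (barnes_Omega M a n))) has_sum
          barnes_zeta_series M a s (w + of_real c) -
           (\<Sum>i\<le>K. (-1) ^ i * pochhammer s i * of_real c ^ i / fact i * barnes_zeta_series M a (s + of_nat i) w))
      (multi_indices M)"
    by (simp add: taylor_rem_def algebra_simps sum_negf)
qed

text \<open>\<open>\<zeta>\<^sub>M\<close> has at most simple poles, at \<open>s = 1, \<dots>, M\<close>; the Pochhammer factor removes them.\<close>

definition barnes_cont :: "nat \<Rightarrow> (nat \<Rightarrow> real) \<Rightarrow> real \<Rightarrow> (complex \<Rightarrow> complex \<Rightarrow> complex) \<Rightarrow> bool" where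
  "barnes_cont M a \<sigma> E \<longleftrightarrow> sep_holo \<sigma> E \<and>
     (\<forall>s w. Re s > real M \<longrightarrow> w \<in> slit_plane \<longrightarrow>
        E s w = pochhammer (s - of_nat M) M * barnes_zeta_series M a s w)"

lemma holomorphic_pochhammer [holomorphic_intros]:
  "f holomorphic_on S \<Longrightarrow> (\<lambda>s. pochhammer (f s) k) holomorphic_on S" for f :: "complex \<Rightarrow> complex"
  by (simp add: pochhammer_prod) (intro holomorphic_intros)

text \<open>Identities between continuations are verified far to the right, where all series
  converge, and carried to the left by this form of the identity theorem.\<close>

lemma holomorphic_eq_halfplane:
  assumes "f holomorphic_on {s. Re s > \<sigma>}" "g holomorphic_on {s. Re s > \<sigma>}"
    and "\<And>s. Re s > \<sigma> \<Longrightarrow> Re s > r \<Longrightarrow> f s = g s" and "Re s > \<sigma>"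
  shows "f s = g s"
proof (rule analytic_continuation_open[where f = f and g = g and z = s and s = "{s. Re s > max \<sigma> r}" and s' = "{s. Re s > \<sigma>}"])
  show "{s. Re s > max \<sigma> r} \<noteq> {}" using complex_eq_iff by (auto intro!: exI[of _ "of_real (max \<sigma> r + 1)"])
  have "{s. Re s > max \<sigma> r} = {s. Re s > \<sigma>} \<inter> {s. Re s > r}" by auto
  thus "open {s. Re s > max \<sigma> r}" by (auto intro!: open_halfspace_Re_gt)
  show "connected {s. Re s > \<sigma>}" by (intro convex_connected convex_halfspace_Re_gt)
qed (use assms in \<open>auto intro: open_halfspace_Re_gt\<close>)

lemma barnes_cont_unique:
  assumes "barnes_cont M a \<sigma> E" "barnes_cont M a \<sigma>' E'" "Re s > \<sigma>" "Re s > \<sigma>'" "w \<in> slit_plane"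
  shows "E s w = E' s w"
proof (rule holomorphic_eq_halfplane[where f = "\<lambda>s. E s w" and g = "\<lambda>s. E' s w" and s = s
      and \<sigma> = "max \<sigma> \<sigma>'" and r = "real M"])
  show "(\<lambda>s. E s w) holomorphic_on {s. Re s > max \<sigma> \<sigma>'}" "(\<lambda>s. E' s w) holomorphic_on {s. Re s > max \<sigma> \<sigma>'}"
    using assms(1,2,5) sep_holoD(1) sep_holo_mono unfolding barnes_cont_def by (meson max.cobounded1 max.cobounded2)+
qed (use assms in \<open>auto simp: barnes_cont_def\<close>)

text \<open>Write \<open>c = a\<^sub>M\<^sub>+\<^sub>1\<close>.  Expanding \<open>\<zeta>\<^sub>M\<^sub>+\<^sub>1(s, w + c)\<close> by Taylor's theorem in
  \<open>\<zeta>\<^sub>M\<^sub>+\<^sub>1(s, w) - \<zeta>\<^sub>M\<^sub>+\<^sub>1(s, w + c) = \<zeta>\<^sub>M(s, w)\<close> expresses \<open>c s \<zeta>\<^sub>M\<^sub>+\<^sub>1(s + 1, w)\<close> through \<open>\<zeta>\<^sub>M(s, w)\<close>,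
  the values \<open>\<zeta>\<^sub>M\<^sub>+\<^sub>1(s + i, w)\<close> with \<open>i \<ge> 2\<close>, and a remainder series that converges further to
  the left.\<close>

lemma barnes_cont_extend:
  assumes a: "\<forall>i\<in>{1..Suc M}. a i > 0" and F: "\<And>\<sigma>. barnes_cont M a \<sigma> F"
    and E: "barnes_cont (Suc M) a \<sigma> E" and \<sigma>: "\<sigma> \<le> real (Suc M)"
  shows "\<exists>E'. barnes_cont (Suc M) a (\<sigma> - 1) E'"
proof -
  define c where "c = a (Suc M)"
  have c: "c > 0" using a by (simp add: c_def)
  \<comment> \<open>Large enough for the remainder series to converge on
    \<open>Re s > \<sigma> - 2\<close>, and at least 1 so that the linear Taylor term, which carries
    the unknown value at \<open>s + 1\<close>, is present.\<close>
  define K where "K = Suc (nat \<lceil>real M + 2 - \<sigma>\<rceil>)"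
  have K: "K \<ge> 1" "(\<sigma> - 2) + real (Suc K) \<ge> real (Suc M)" unfolding K_def by linarith+
  define D where "D = (\<lambda>s w. \<Sum>\<^sub>\<infinity>n\<in>multi_indices (Suc M). taylor_rem K c s (w + of_real (barnes_Omega (Suc M) a n)))"
  have D: "sep_holo (\<sigma> - 2) D" unfolding D_def using K c by (intro sep_holo_taylor_rem_sum a) auto
  \<comment> \<open>The difference equation multiplied by \<open>pochhammer (s - M) M\<close> and
    solved for \<open>c * s\<close> times the value at \<open>s + 1\<close>. Only shifts
    \<open>i \<ge> 2\<close> of \<open>E\<close> occur, so everything is holomorphic on
    \<open>Re s > \<sigma> - 2\<close>; replacing \<open>s\<close> by \<open>s - 1\<close> then
    gains one unit over \<open>E\<close>.\<close>
  define G where "G = (\<lambda>s w. F s w + pochhammer (s - of_nat M) M * D s w +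
      (\<Sum>i\<in>{2..K}. ((-1) ^ i * of_real c ^ i / fact i * pochhammer (s - of_nat M) (i - 1)) * E (s + of_nat i) w))"
  have "sep_holo (\<sigma> - 2) G" unfolding G_def
  proof (intro sep_holo_add sep_holo_sum sep_holo_mult D holomorphic_intros)
    show "sep_holo (\<sigma> - 2) F" using F by (simp add: barnes_cont_def)
    show "sep_holo (\<sigma> - 2) (\<lambda>s. E (s + of_nat i))" if "i \<in> {2..K}" for i
      using E that by (intro sep_holo_shift[where \<sigma> = \<sigma>]) (auto simp: barnes_cont_def)
  qed
  hence "sep_holo (\<sigma> - 1) (\<lambda>s w. (1 / of_real c) * G (s + (-1)) w)"
    by (intro sep_holo_mult holomorphic_intros sep_holo_shift[where \<sigma> = "\<sigma> - 2"]) auto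
  moreover define E' where "E' = (\<lambda>s w. (1 / of_real c) * G (s + (-1)) w)"
  ultimately have E': "sep_holo (\<sigma> - 1) E'" by simp
  have key: "E' (s + 1) w = pochhammer (s + 1 - of_nat (Suc M)) (Suc M) * barnes_zeta_series (Suc M) a (s + 1) w"
    if s: "Re s > real (Suc M)" and w: "w \<in> slit_plane" for s w
  proof -
    define Z where "Z = (\<lambda>i. barnes_zeta_series (Suc M) a (s + of_nat i) w)"
    define t where "t = (\<lambda>i. (-1) ^ i * pochhammer s i * of_real c ^ i / fact i * Z i)"
    define P where "P = pochhammer (s - of_nat M) M"
    have "D s w = barnes_zeta_series (Suc M) a s (w + of_real c) - (\<Sum>i\<le>K. t i)"
      unfolding D_def t_def Z_def using a s w c by (intro taylor_rem_sum_eq) auto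
    also have "barnes_zeta_series (Suc M) a s (w + of_real c) = Z 0 - barnes_zeta_series M a s w"
      using barnes_zeta_series_diff[OF a s w] by (simp add: Z_def c_def algebra_simps)
    also have "(\<Sum>i\<le>K. t i) = Z 0 - of_real c * s * Z 1 + (\<Sum>i\<in>{2..K}. t i)"
    proof -
      have "{..K} = {0, 1} \<union> {2..K}" using K(1) by auto
      also have "sum t \<dots> = sum t {0, 1} + (\<Sum>i\<in>{2..K}. t i)" by (intro sum.union_disjoint) auto
      finally show ?thesis by (simp add: t_def)
    qed
    finally have D_eq: "D s w = of_real c * s * Z 1 - barnes_zeta_series M a s w - (\<Sum>i\<in>{2..K}. t i)" by simp
    have F_eq: "F s w = P * barnes_zeta_series M a s w"
      using F[of 0] s w by (simp add: barnes_cont_def P_def)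
    \<comment> \<open>Both sides are \<open>pochhammer (s - M) (M + i)\<close>, split after
      \<open>M\<close> factors and after \<open>i - 1\<close> factors. The second splitting isolates
      the factor built into \<open>E\<close> at \<open>s + i\<close>.\<close>
    have poch: "P * pochhammer s i = pochhammer (s - of_nat M) (i - 1) * pochhammer (s + of_nat i - of_nat (Suc M)) (Suc M)"
      if "i \<ge> 1" for i
    proof -
      have "P * pochhammer s i = pochhammer (s - of_nat M) (M + i)"
        by (simp add: P_def pochhammer_product')
      also have "M + i = (i - 1) + Suc M" using that by simp
      also have "pochhammer (s - of_nat M) \<dots> =
          pochhammer (s - of_nat M) (i - 1) * pochhammer (s - of_nat M + of_nat (i - 1)) (Suc M)"
        by (rule pochhammer_product')
      also have "s - of_nat M + of_nat (i - 1) = s + of_nat i - of_nat (Suc M)" using that by (simp add: of_nat_diff)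
      finally show ?thesis .
    qed
    have E_eq: "((-1) ^ i * of_real c ^ i / fact i * pochhammer (s - of_nat M) (i - 1)) * E (s + of_nat i) w = P * t i"
      if "i \<in> {2..K}" for i
    proof -
      have "E (s + of_nat i) w = pochhammer (s + of_nat i - of_nat (Suc M)) (Suc M) * Z i"
        using E s w by (simp add: barnes_cont_def Z_def)
      moreover have "P * t i = (-1) ^ i * of_real c ^ i / fact i * (P * pochhammer s i) * Z i"
        by (simp add: t_def)
      ultimately show ?thesis using poch[of i] that by (simp only: mult_ac) simp
    qed
    have "G s w = P * barnes_zeta_series M a s w + P * D s w + (\<Sum>i\<in>{2..K}. P * t i)"
      unfolding G_def F_eq P_def[symmetric] by (intro arg_cong2[of _ _ _ _ "(+)"] sum.cong refl E_eq)
    also have "\<dots> = of_real c * (P * s) * Z 1"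
      unfolding D_eq by (simp add: algebra_simps sum_distrib_left)
    also have "P * s = pochhammer (s + 1 - of_nat (Suc M)) (Suc M)" using poch[of 1] by simp
    finally show ?thesis using c by (simp add: E'_def Z_def)
  qed
  have "barnes_cont (Suc M) a (\<sigma> - 1) E'" unfolding barnes_cont_def
  proof (intro conjI allI impI E')
    fix s w assume s: "Re s > real (Suc M)" and w: "w \<in> slit_plane"
    \<comment> \<open>\<open>key\<close> compares only for \<open>Re s > M + 2\<close>, since it
      speaks about \<open>s + 1\<close>; the strip between \<open>M + 1\<close> and
      \<open>M + 2\<close> is filled by the identity theorem.\<close>
    show "E' s w = pochhammer (s - of_nat (Suc M)) (Suc M) * barnes_zeta_series (Suc M) a s w"
    proof (rule holomorphic_eq_halfplane[where f = "\<lambda>s. E' s w" and s = s and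
        g = "\<lambda>s. pochhammer (s - of_nat (Suc M)) (Suc M) * barnes_zeta_series (Suc M) a s w" and
        \<sigma> = "real (Suc M)" and r = "real (Suc M) + 1"])
      show "(\<lambda>s. E' s w) holomorphic_on {s. Re s > real (Suc M)}"
        using \<sigma> w by (intro sep_holoD(1)[OF sep_holo_mono[OF E']]) auto
      show "(\<lambda>s. pochhammer (s - of_nat (Suc M)) (Suc M) * barnes_zeta_series (Suc M) a s w) holomorphic_on {s. Re s > real (Suc M)}"
        using w by (intro holomorphic_intros sep_holoD(1)[OF sep_holo_barnes_zeta_series] a) auto
      fix s :: complex assume "Re s > real (Suc M) + 1"
      thus "E' s w = pochhammer (s - of_nat (Suc M)) (Suc M) * barnes_zeta_series (Suc M) a s w"
        using key[of "s - 1" w] w by simp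
    qed (use s in auto)
  qed
  thus ?thesis by blast
qed

lemma barnes_cont_0: "barnes_cont 0 a \<sigma> (\<lambda>s w. w powr (- s))"
proof -
  have "sep_holo \<sigma> (\<lambda>s w. w powr (- s))" unfolding sep_holo_def
  proof (intro conjI ballI allI impI)
    show "(\<lambda>s. w powr (- s)) holomorphic_on {s. \<sigma> < Re s}" if "w \<in> slit_plane" for w
      using powr_deriv_holomorphic(1)[OF that, of 0] by simp
    show "(\<lambda>w. w powr (- s)) holomorphic_on slit_plane" for s
      using powr_deriv_holomorphic(2)[of s 0] by (rule holomorphic_transform) simp
    fix K1 K2 :: "complex set" assume K: "compact K1" "compact K2" "K2 \<subseteq> slit_plane"
    obtain R where R: "\<And>s. s \<in> K1 \<Longrightarrow> norm s \<le> R" 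
      using compact_continuous_bound[OF K(1), of "\<lambda>s. s"] by auto
    have "- R \<le> Re s" if "s \<in> K1" for s using R[OF that] abs_Re_le_cmod[of s] by linarith
    then obtain C where "C \<ge> 0" and C:
      "\<And>s w x. s \<in> K1 \<Longrightarrow> w \<in> K2 \<Longrightarrow> 0 \<le> x \<Longrightarrow> norm ((w + of_real x) powr (- s)) \<le> C * (1 + x) powr (- (- R))"
      using powr_shift_bound[OF K] by metis
    have "norm (w powr (- s)) \<le> C" if "s \<in> K1" "w \<in> K2" for s w
      using C[OF that, of 0] by simp
    thus "\<exists>B. \<forall>s\<in>K1. \<forall>w\<in>K2. norm (w powr (- s)) \<le> B" by blast
  qed
  thus ?thesis unfolding barnes_cont_def by (auto simp: barnes_zeta_series_def barnes_Omega_def)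
qed

lemma barnes_cont_exists:
  assumes "\<forall>i\<in>{1..M}. a i > 0"
  shows "\<exists>E. \<forall>\<sigma>. barnes_cont M a \<sigma> E"
  using assms
proof (induction M)
  case 0
  thus ?case using barnes_cont_0 by blast
next
  case (Suc M)
  note a = Suc.prems
  define M' where "M' = real (Suc M)"
  obtain F where F: "\<And>\<sigma>. barnes_cont M a \<sigma> F" using Suc by auto
  have "\<exists>E. barnes_cont (Suc M) a (M' - real k) E" for k
  proof (induction k)
    case 0
    have "sep_holo M' (\<lambda>s w. pochhammer (s - of_nat (Suc M)) (Suc M) * barnes_zeta_series (Suc M) a s w)"
      unfolding M'_def by (intro sep_holo_mult holomorphic_intros sep_holo_barnes_zeta_series Suc)
    thus ?case unfolding barnes_cont_def by auto
  next
    case (Suc k)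
    then obtain E where "barnes_cont (Suc M) a (M' - real k) E" by blast
    from barnes_cont_extend[OF a F this] show ?case
      by (simp add: M'_def algebra_simps)
  qed
  then obtain E where E: "\<And>k. barnes_cont (Suc M) a (M' - real k) (E k)" by metis
  \<comment> \<open>A strip reaching strictly to the left of \<open>s\<close>. By uniqueness the
    value does not depend on which such strip is taken, so the pieces glue to one function serving
    all \<open>\<sigma>\<close>.\<close>
  define k where "k = (\<lambda>s. Suc (nat \<lceil>M' - Re s\<rceil>))"
  have k: "Re s > M' - real (k s)" for s unfolding k_def by linarith
  define E' where "E' = (\<lambda>s w. E (k s) s w)"
  have "barnes_cont (Suc M) a \<sigma> E'" for \<sigma> unfolding barnes_cont_def
  proof (intro conjI allI impI)
    define l where "l = nat \<lceil>M' - \<sigma>\<rceil>"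
    have l: "M' - real l \<le> \<sigma>" unfolding l_def by linarith
    have "sep_holo \<sigma> (E l)" using E[of l] l by (auto simp: barnes_cont_def intro: sep_holo_mono)
    also have "sep_holo \<sigma> (E l) \<longleftrightarrow> sep_holo \<sigma> E'"
      using l k unfolding E'_def by (intro sep_holo_cong barnes_cont_unique[OF E E]) (auto intro: le_less_trans)
    finally show "sep_holo \<sigma> E'" .
    show "E' s w = pochhammer (s - of_nat (Suc M)) (Suc M) * barnes_zeta_series (Suc M) a s w"
      if "Re s > real (Suc M)" "w \<in> slit_plane" for s w
      using E[of "k s"] that by (auto simp: barnes_cont_def E'_def)
  qed
  thus ?case by blast
qed

subsection \<open>The multiple log-gamma function\<close>

text \<open>Difference quotients in \<open>s\<close> are holomorphic in \<open>w\<close>. They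
  converge uniformly on small discs in \<open>w\<close>, because Cauchy's inequality turns the joint
  bound on \<open>F\<close> into a bound on its second \<open>s\<close>-derivative.\<close>

lemma sep_holo_deriv:
  assumes F: "sep_holo \<sigma> F" and s0: "Re s0 > \<sigma>"
  shows "(\<lambda>w. deriv (\<lambda>s. F s w) s0) holomorphic_on slit_plane"
proof -
  define H where "H = {s. Re s > \<sigma>}"
  have "open H" "s0 \<in> H" using s0 by (auto simp: H_def open_halfspace_Re_gt)
  then obtain r' where r': "r' > 0" "cball s0 r' \<subseteq> H" using open_contains_cball by blast
  \<comment> \<open>Halving leaves room for a Cauchy disc of radius \<open>r\<close> around every
    point of \<open>cball s0 r\<close>.\<close>
  define r where "r = r' / 2"
  have r: "r > 0" "cball s0 (2 * r) \<subseteq> H" using r' by (auto simp: r_def)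
  define h where "h = (\<lambda>n. complex_of_real (r / real (Suc n)))"
  have h: "h n \<noteq> 0" "norm (h n) = r / real (Suc n)" "norm (h n) \<le> r" for n
  proof -
    show "h n \<noteq> 0" using r by (simp add: h_def del: of_nat_Suc of_real_divide)
    show *: "norm (h n) = r / real (Suc n)" using r unfolding h_def norm_of_real by simp
    show "norm (h n) \<le> r" unfolding * using r by (simp add: field_simps)
  qed
  show ?thesis
  proof (rule holomorphic_uniform_sequence[OF open_slit_plane])
    show "(\<lambda>w. (F (s0 + h n) w - F s0 w) / h n) holomorphic_on slit_plane" for n
    proof -
      have "s0 + h n \<in> cball s0 (2 * r)" using h(3)[of n] r by (simp add: dist_norm)
      hence "Re (s0 + h n) > \<sigma>" using r by (auto simp: H_def)
      thus ?thesis using s0 h by (intro holomorphic_intros sep_holoD(2)[OF F]) auto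
    qed
    fix x :: complex assume "x \<in> slit_plane"
    then obtain d where d: "d > 0" "cball x d \<subseteq> slit_plane" using open_slit_plane open_contains_cball by blast
    obtain B where B: "B \<ge> 0" "\<And>s w. s \<in> cball s0 (2 * r) \<Longrightarrow> w \<in> cball x d \<Longrightarrow> norm (F s w) \<le> B"
      using sep_holoD(3)[OF F, of "cball s0 (2 * r)" "cball x d"] r d by (auto simp: H_def)
    have bound: "norm ((F (s0 + h n) w - F s0 w) / h n - deriv (\<lambda>s. F s w) s0) \<le> (2 * B / r\<^sup>2) * (r / real (Suc n))"
      if w: "w \<in> cball x d" for n w
    proof -
      define f where "f = (\<lambda>s. F s w)"
      have f: "f holomorphic_on H" unfolding f_def H_def using w d by (intro sep_holoD(1)[OF F]) auto
      have "norm ((deriv ^^ 0) f (s0 + h n) - (\<Sum>i\<le>1. (deriv ^^ i) f s0 * ((s0 + h n) - s0) ^ i / fact i))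
          \<le> (2 * B / r\<^sup>2) * norm ((s0 + h n) - s0) ^ Suc 1 / fact 1"
      proof (rule complex_Taylor[where S = "cball s0 r"])
        show "((deriv ^^ i) f has_field_derivative (deriv ^^ Suc i) f y) (at y within cball s0 r)"
          if "y \<in> cball s0 r" for i y
        proof -
          have "y \<in> H" using that r by (intro subsetD[OF r(2)]) auto
          hence "((deriv ^^ i) f has_field_derivative deriv ((deriv ^^ i) f) y) (at y)"
            using \<open>open H\<close> f by (intro holomorphic_derivI[of _ H] holomorphic_higher_deriv) auto
          thus ?thesis by (simp add: has_field_derivative_at_within)
        qed
        show "norm ((deriv ^^ Suc 1) f y) \<le> 2 * B / r\<^sup>2" if y: "y \<in> cball s0 r" for y
        proof -
          have sub: "cball y r \<subseteq> cball s0 (2 * r)" 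
          proof
            fix z assume "z \<in> cball y r"
            thus "z \<in> cball s0 (2 * r)" using y dist_triangle[of s0 z y] by simp
          qed
          have "f holomorphic_on cball y r" using sub r(2) by (intro holomorphic_on_subset[OF f]) auto
          hence "norm ((deriv ^^ 2) f y) \<le> fact 2 * B / r ^ 2"
            using r(1) sub B(2) w unfolding f_def
            by (intro Cauchy_inequality) (auto intro: holomorphic_on_imp_continuous_on holomorphic_on_subset simp: dist_norm)
          thus ?thesis by (simp add: numeral_2_eq_2)
        qed
      qed (use h(3) r in \<open>auto simp: dist_norm\<close>)
      hence "norm (f (s0 + h n) - f s0 - deriv f s0 * h n) \<le> (2 * B / r\<^sup>2) * norm (h n) ^ 2"
        by (simp add: numeral_2_eq_2 algebra_simps)
      moreover have "(f (s0 + h n) - f s0) / h n - deriv f s0 = (f (s0 + h n) - f s0 - deriv f s0 * h n) / h n"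
        using h(1) by (simp add: field_simps)
      ultimately have "norm ((f (s0 + h n) - f s0) / h n - deriv f s0) \<le> (2 * B / r\<^sup>2) * norm (h n) ^ 2 / norm (h n)"
        by (simp only: norm_divide) (rule divide_right_mono, auto)
      also have "\<dots> = (2 * B / r\<^sup>2) * (r / real (Suc n))"
        using h(1)[of n] by (simp only: h(2)[of n, symmetric]) (simp add: power2_eq_square)
      finally show ?thesis by (simp add: f_def)
    qed
    have "(\<lambda>n. (2 * B / r\<^sup>2) * (r / real (Suc n))) \<longlonglongrightarrow> (2 * B / r\<^sup>2) * 0"
      by (intro tendsto_mult tendsto_const lim_const_over_n[THEN LIMSEQ_Suc])
    hence "uniform_limit (cball x d) (\<lambda>n w. (F (s0 + h n) w - F s0 w) / h n) (\<lambda>w. deriv (\<lambda>s. F s w) s0) sequentially"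
    proof (intro uniform_limitI)
      fix e :: real assume "e > 0" and lim: "(\<lambda>n. (2 * B / r\<^sup>2) * (r / real (Suc n))) \<longlonglongrightarrow> (2 * B / r\<^sup>2) * 0"
      hence "\<forall>\<^sub>F n in sequentially. (2 * B / r\<^sup>2) * (r / real (Suc n)) < e"
        by (intro order_tendstoD) auto
      thus "\<forall>\<^sub>F n in sequentially. \<forall>w\<in>cball x d. dist ((F (s0 + h n) w - F s0 w) / h n) (deriv (\<lambda>s. F s w) s0) < e"
        by eventually_elim (use bound in \<open>fastforce simp: dist_norm intro: le_less_trans\<close>)
    qed
    thus "\<exists>d>0. cball x d \<subseteq> slit_plane \<and>
        uniform_limit (cball x d) (\<lambda>n w. (F (s0 + h n) w - F s0 w) / h n) (\<lambda>w. deriv (\<lambda>s. F s w) s0) sequentially"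
      using d by blast
  qed
qed

section \<open>Uniqueness of the meromorphic continuation and identification of
  \<open>barnes_L\<close>\<close>

text \<open>The difference vanishes on a cosparse set or is nonzero on one; agreement on an open set
  excludes the latter. So the functions agree in a punctured neighbourhood of each point, and the
  normalisation (value 0 at poles, limit elsewhere) settles the point itself.\<close>

lemma nicely_meromorphic_eq:
  assumes f: "f nicely_meromorphic_on UNIV" and g: "g nicely_meromorphic_on UNIV"
    and S: "open S" "S \<noteq> {}" and eq: "\<And>z. z \<in> S \<Longrightarrow> f z = g z"
  shows "f = g"
proof
  fix z
  have mero: "f meromorphic_on UNIV" "g meromorphic_on UNIV"
    using f g by (auto simp: nicely_meromorphic_on_def)
  have "(\<forall>\<^sub>\<approx>x\<in>UNIV. f x - g x = 0) \<or> (\<forall>\<^sub>\<approx>x\<in>UNIV. f x - g x \<noteq> 0)"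
    using mero by (intro meromorphic_imp_constant_or_avoid) (auto intro!: meromorphic_intros)
  moreover have "\<not> (\<forall>\<^sub>\<approx>x\<in>UNIV. f x - g x \<noteq> 0)"
  proof
    assume *: "\<forall>\<^sub>\<approx>x\<in>UNIV. f x - g x \<noteq> 0"
    obtain y where y: "y \<in> S" using S by blast
    have "\<forall>\<^sub>F x in at y. f x - g x \<noteq> 0" using * by (simp add: eventually_cosparse_open_eq)
    moreover have "\<forall>\<^sub>F x in at y. x \<in> S" using S(1) y by (rule eventually_at_in_open')
    ultimately have "\<forall>\<^sub>F x in at y. False" by eventually_elim (use eq in auto)
    thus False by simp
  qed
  ultimately have "\<forall>\<^sub>F x in at z. f x - g x = 0" by (auto simp: eventually_cosparse_open_eq)
  hence ev: "\<forall>\<^sub>F x in at z. f x = g x" by eventually_elim auto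
  show "f z = g z"
  proof (cases "is_pole f z")
    case True
    moreover have "is_pole g z" using True ev is_pole_cong by blast
    ultimately show ?thesis using f g not_tendsto_and_filterlim_at_infinity[OF at_neq_bot]
      unfolding nicely_meromorphic_on_def is_pole_def by (metis UNIV_I)
  next
    case False
    hence "\<not> is_pole g z" using ev is_pole_cong by blast
    hence "g \<midarrow>z\<rightarrow> g z" "f \<midarrow>z\<rightarrow> f z" using f g False by (auto simp: nicely_meromorphic_on_def)
    moreover have "f \<midarrow>z\<rightarrow> g z" using \<open>g \<midarrow>z\<rightarrow> g z\<close> ev tendsto_cong by blast
    ultimately show ?thesis using LIM_unique by blast
  qed
qed

text \<open>The zeros are the integers from 1 to \<open>M\<close>, the possible poles of the zeta
  function.\<close>

lemma pochhammer_shift_neq_0: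
  fixes s :: complex
  assumes "Re s < 1 \<or> Re s > real M"
  shows "pochhammer (s - of_nat M) M \<noteq> 0"
proof
  assume "pochhammer (s - of_nat M) M = 0"
  then obtain k where k: "k < M" "s - of_nat M = - of_nat k" by (auto simp: pochhammer_eq_0_iff)
  hence "s = of_nat (M - k)" by (simp add: of_nat_diff algebra_simps)
  thus False using assms k by auto
qed

text \<open>The description picks \<open>remove_sings\<close> of the quotient. For
  \<open>Re s < 1\<close> this is the quotient itself, so it need not be decided which of
  \<open>1, ..., M\<close> are genuine poles.\<close>

lemma barnes_zeta_eq:
  assumes E: "\<And>\<sigma>. barnes_cont M a \<sigma> E" and w: "w \<in> slit_plane" and s: "Re s < 1"
  shows "barnes_zeta M a s w = E s w / pochhammer (s - of_nat M) M"
proof -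
  define Z0 where "Z0 = (\<lambda>s. E s w / pochhammer (s - of_nat M) M)"
  have hol: "(\<lambda>s. E s w) holomorphic_on UNIV"
  proof (subst holomorphic_on_open[OF open_UNIV], safe)
    fix z :: complex
    have "(\<lambda>s. E s w) holomorphic_on {s. Re s > Re z - 1}"
      using E w by (auto simp: barnes_cont_def dest: sep_holoD)
    thus "\<exists>f'. ((\<lambda>s. E s w) has_field_derivative f') (at z)"
      by (subst (asm) holomorphic_on_open[OF open_halfspace_Re_gt]) auto
  qed
  have mero: "Z0 meromorphic_on UNIV" unfolding Z0_def
    by (intro meromorphic_intros analytic_on_imp_meromorphic_on)
       (auto simp: analytic_on_open intro!: hol holomorphic_intros)
  have ana: "Z0 analytic_on {s}" if "Re s < 1 \<or> Re s > real M" for s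
    unfolding Z0_def using pochhammer_shift_neq_0[OF that] hol
    by (intro analytic_on_divide) (auto intro!: holomorphic_on_imp_analytic_at[of _ UNIV] holomorphic_intros)
  have eq: "remove_sings Z0 s = Z0 s" if "Re s < 1 \<or> Re s > real M" for s
    using ana[OF that] by simp
  have ser: "Z0 s = barnes_zeta_series M a s w" if "Re s > real M" for s
    using E[of 0] that w pochhammer_shift_neq_0[of s M] by (simp add: Z0_def barnes_cont_def)
  have "barnes_zeta M a s w = remove_sings Z0 s"
    unfolding barnes_zeta_def
  proof (rule arg_cong[where f = "\<lambda>Z. Z s"], rule the_equality)
    show *: "remove_sings Z0 nicely_meromorphic_on UNIV \<and> (\<forall>s. real M < Re s \<longrightarrow> remove_sings Z0 s = barnes_zeta_series M a s w)"
      using remove_sings_nicely_meromorphic[OF mero] eq ser by auto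
    fix Z assume Z: "Z nicely_meromorphic_on UNIV \<and> (\<forall>s. real M < Re s \<longrightarrow> Z s = barnes_zeta_series M a s w)"
    show "Z = remove_sings Z0"
    proof (rule nicely_meromorphic_eq[where S = "{s. Re s > real M}"])
      show "{s. real M < Re s} \<noteq> {}" by (auto intro!: exI[of _ "of_real (real M + 1)"])
    qed (use Z * in \<open>auto intro: open_halfspace_Re_gt\<close>)
  qed
  thus ?thesis using eq s by (simp add: Z0_def)
qed

lemma barnes_cont_holomorphic:
  assumes "barnes_cont M a \<sigma> E" "\<sigma> \<le> \<sigma>'" "w \<in> slit_plane"
  shows "(\<lambda>s. E s w) holomorphic_on {s. Re s > \<sigma>'}"
  using assms sep_holo_mono sep_holoD(1) unfolding barnes_cont_def by blast

text \<open>The right-hand side is a witness for the choice in \<open>barnes_L\<close>, and the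
  identity theorem on the connected slit plane forces any other witness to agree with it.\<close>

lemma barnes_L_eq:
  assumes E: "\<And>\<sigma>. barnes_cont M a \<sigma> E" and w: "w \<in> slit_plane"
  shows "barnes_L M a w = deriv (\<lambda>s. E s w / pochhammer (s - of_nat M) M) 0"
proof (cases "M = 0")
  case True
  have "E s w = w powr (- s)" for s
    using barnes_cont_unique[OF E[of "Re s - 1"] _ _ _ w, of "Re s - 1" "\<lambda>s w. w powr (- s)" s] barnes_cont_0 True by auto
  hence "deriv (\<lambda>s. E s w / pochhammer (s - of_nat M) M) 0 = deriv (\<lambda>s. w powr (- s)) 0" using True by simp
  also have "\<dots> = - Ln w"
  proof (rule DERIV_imp_deriv)
    have "w \<noteq> 0" using w by auto
    thus "((\<lambda>s. w powr (- s)) has_field_derivative - Ln w) (at 0)"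
      by (auto simp: powr_def intro!: derivative_eq_intros)
  qed
  finally show ?thesis using True by (simp add: barnes_L_def)
next
  case False
  define P where "P = (\<lambda>s. pochhammer (s - of_nat M) M :: complex)"
  define G where "G = (\<lambda>w. deriv (\<lambda>s. E s w / P s) 0)"
  have P: "P 0 \<noteq> 0" unfolding P_def by (rule pochhammer_shift_neq_0) auto
  have P_hol: "P holomorphic_on UNIV" unfolding P_def by (intro holomorphic_intros)
  \<comment> \<open>The quotient rule separates the dependence on \<open>w\<close>: only
    \<open>E 0 w\<close> and the \<open>s\<close>-derivative of \<open>E\<close> remain, and both
    are known to be holomorphic in \<open>w\<close>.\<close>
  have G_eq: "G w = (deriv (\<lambda>s. E s w) 0 * P 0 - E 0 w * deriv P 0) / (P 0 * P 0)" if w: "w \<in> slit_plane" for w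
    unfolding G_def
  proof (intro DERIV_imp_deriv DERIV_divide P)
    show "((\<lambda>s. E s w) has_field_derivative deriv (\<lambda>s. E s w) 0) (at 0)"
      by (rule holomorphic_derivI[OF barnes_cont_holomorphic[OF E _ w, of "-1" "-1"]]) (auto intro: open_halfspace_Re_gt)
    show "(P has_field_derivative deriv P 0) (at 0)" using P_hol by (intro holomorphic_derivI[of _ UNIV]) auto
  qed
  have "(\<lambda>w. (deriv (\<lambda>s. E s w) 0 * P 0 - E 0 w * deriv P 0) / (P 0 * P 0)) holomorphic_on slit_plane"
    using E[of "-1"] P by (intro holomorphic_intros sep_holo_deriv[of "-1"] sep_holoD(2)[of "-1"]) (auto simp: barnes_cont_def)
  hence G_hol: "G holomorphic_on slit_plane" by (rule holomorphic_transform) (use G_eq in auto)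
  have G_zeta: "G w = deriv (\<lambda>s. barnes_zeta M a s w) 0" if w: "w \<in> slit_plane" for w
    unfolding G_def
  proof (rule deriv_cong_ev)
    have "\<forall>\<^sub>F s in nhds (0::complex). s \<in> {s. Re s < 1}"
      by (intro eventually_nhds_in_open) (auto intro: open_halfspace_Re_lt)
    thus "\<forall>\<^sub>F s in nhds 0. E s w / P s = barnes_zeta M a s w"
      by eventually_elim (use barnes_zeta_eq[OF E w] in \<open>auto simp: P_def\<close>)
  qed auto
  define Q where "Q = (\<lambda>f. f holomorphic_on slit_plane \<and> (\<forall>w. Re w > 0 \<longrightarrow> f w = deriv (\<lambda>s. barnes_zeta M a s w) 0))"
  have "Q G" unfolding Q_def using G_hol G_zeta by (auto simp: complex_nonpos_Reals_iff)
  hence "Q (Eps Q)" by (rule someI[of Q G])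
  have "Eps Q w = G w"
  proof (rule analytic_continuation_open[where s = "{w. Re w > 0}" and s' = slit_plane and f = "Eps Q" and g = G])
    show "{w::complex. Re w > 0} \<noteq> {}" by (auto intro!: exI[of _ 1])
  qed (use \<open>Q G\<close> \<open>Q (Eps Q)\<close> w in \<open>auto simp: Q_def complex_nonpos_Reals_iff open_halfspace_Re_gt open_slit_plane connected_slit_plane\<close>)
  thus ?thesis using False unfolding barnes_L_def Q_def G_def P_def by simp
qed

subsection \<open>The product formula\<close>

lemma barnes_S_0: "barnes_S 0 h b z = h (z + of_real (b 0))"
  by (simp add: barnes_S_def)

text \<open>Splitting the subsets by membership of the last index shows \<open>barnes_S\<close> as
  an iterated difference with steps \<open>b 1, ..., b N\<close>, the form in which it can be
  estimated inductively.\<close>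

lemma barnes_S_Suc: "barnes_S (Suc N) h b z = barnes_S N h b z - barnes_S N h b (z + of_real (b (Suc N)))"
proof -
  define t where "t = (\<lambda>J. (-1) ^ card J * h (z + of_real (b 0 + (\<Sum>j\<in>J. b j))))"
  have *: "finite J" "Suc N \<notin> J" if "J \<in> Pow {1..N}" for J
    using that finite_subset[of J "{1..N}"] by auto
  have inj: "inj_on (insert (Suc N)) (Pow {1..N})"
    by (rule inj_onI) (metis * Diff_insert_absorb)
  have "barnes_S (Suc N) h b z = sum t (Pow (insert (Suc N) {1..N}))"
    by (simp add: barnes_S_def t_def atLeastAtMostSuc_conv)
  also have "\<dots> = sum t (Pow {1..N}) + sum t (insert (Suc N) ` Pow {1..N})"
    unfolding Pow_insert by (intro sum.union_disjoint) auto
  also have "sum t (insert (Suc N) ` Pow {1..N}) = (\<Sum>J\<in>Pow {1..N}. t (insert (Suc N) J))"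
    using inj by (rule sum.reindex_cong) auto
  also have "\<dots> = (\<Sum>J\<in>Pow {1..N}. - ((-1) ^ card J * h (z + of_real (b (Suc N)) + of_real (b 0 + (\<Sum>j\<in>J. b j)))))"
    by (intro sum.cong refl) (use * in \<open>simp add: t_def algebra_simps\<close>)
  finally show ?thesis by (simp add: barnes_S_def t_def sum_negf)
qed

lemma barnes_S_cong:
  assumes "\<And>J. J \<subseteq> {1..N} \<Longrightarrow> h (z + of_real (b 0 + (\<Sum>j\<in>J. b j))) = h' (z' + of_real (b' 0 + (\<Sum>j\<in>J. b' j)))"
  shows "barnes_S N h b z = barnes_S N h' b' z'"
  unfolding barnes_S_def using assms by (intro sum.cong refl) auto

lemma slit_plane_add_sum:
  assumes "\<forall>j\<in>{1..N}. b j > (0::real)" "J \<subseteq> {1..N}" "z + of_real (b 0) \<in> slit_plane"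
  shows "z + of_real (b 0 + (\<Sum>j\<in>J. b j)) \<in> slit_plane"
proof -
  have "0 \<le> (\<Sum>j\<in>J. b j)" using assms(1,2) by (intro sum_nonneg) (auto simp: less_imp_le)
  from slit_plane_add[OF assms(3) this] show ?thesis by (simp add: add.assoc)
qed

lemma has_field_derivative_barnes_S:
  assumes b: "\<forall>j\<in>{1..N}. b j > 0"
    and h: "\<And>y. y \<in> slit_plane \<Longrightarrow> (h has_field_derivative h' y) (at y)"
    and z: "z + of_real (b 0) \<in> slit_plane"
  shows "(barnes_S N h b has_field_derivative barnes_S N h' b z) (at z)"
  unfolding barnes_S_def
proof (intro DERIV_sum DERIV_cmult)
  fix J assume "J \<in> Pow {1..N}"
  hence "(h has_field_derivative h' (z + of_real (b 0 + (\<Sum>j\<in>J. b j)))) (at (z + of_real (b 0 + (\<Sum>j\<in>J. b j))))"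
    using b z by (intro h slit_plane_add_sum) auto
  thus "((\<lambda>z. h (z + of_real (b 0 + (\<Sum>j\<in>J. b j)))) has_field_derivative h' (z + of_real (b 0 + (\<Sum>j\<in>J. b j)))) (at z)"
    by (simp add: DERIV_shift)
qed

text \<open>By the mean value inequality each difference costs one derivative and a factor
  \<open>b j\<close>. The induction raises \<open>i\<close> as it lowers \<open>N\<close>, so the
  derivative of order \<open>i + N\<close> is the only one that has to be bounded.\<close>

lemma norm_barnes_S_le:
  assumes b: "\<forall>j\<in>{1..N}. b j > 0"
    and h: "\<And>i y. y \<in> slit_plane \<Longrightarrow> (h i has_field_derivative h (Suc i) y) (at y)"
    and z: "z + of_real (b 0) \<in> slit_plane"
    and B: "\<And>x. 0 \<le> x \<Longrightarrow> x \<le> (\<Sum>j=1..N. b j) \<Longrightarrow> norm (h (i + N) (z + of_real (b 0) + of_real x)) \<le> B"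
  shows "norm (barnes_S N (h i) b z) \<le> B * (\<Prod>j=1..N. b j)"
  using b z B
proof (induction N arbitrary: i z)
  case 0
  show ?case using "0.prems"(3)[of 0] by (simp add: barnes_S_0)
next
  case (Suc N)
  define c where "c = b (Suc N)"
  have c: "c > 0" using Suc.prems(1) by (simp add: c_def)
  define S where "S = closed_segment z (z + of_real c)"
  have S: "\<exists>t. 0 \<le> t \<and> t \<le> c \<and> y = z + of_real t" if y: "y \<in> S" for y
  proof -
    obtain u where u: "0 \<le> u" "u \<le> 1" "y = (1 - u) *\<^sub>R z + u *\<^sub>R (z + of_real c)"
      using y unfolding S_def closed_segment_def by auto
    have "y = z + of_real (u * c)" unfolding u(3) by (simp add: scaleR_conv_of_real algebra_simps)
    moreover have "u * c \<le> 1 * c" using u c by (intro mult_right_mono) auto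
    ultimately show ?thesis using u c by (intro exI[of _ "u * c"]) auto
  qed
  have sum_Suc: "(\<Sum>j=1..Suc N. b j) = (\<Sum>j=1..N. b j) + c" by (simp add: c_def)
  have "norm (barnes_S N (h i) b z - barnes_S N (h i) b (z + of_real c)) \<le>
          B * (\<Prod>j=1..N. b j) * norm (z - (z + of_real c))"
  proof (rule field_differentiable_bound[where S = S])
    fix y assume "y \<in> S"
    then obtain t where t: "0 \<le> t" "t \<le> c" "y = z + of_real t" using S by blast
    have y: "y + of_real (b 0) \<in> slit_plane"
      using slit_plane_add[OF Suc.prems(2) t(1)] by (simp add: t(3) add_ac)
    show "(barnes_S N (h i) b has_field_derivative barnes_S N (h (Suc i)) b y) (at y within S)"
      by (rule has_field_derivative_at_within,
          rule has_field_derivative_barnes_S[where h = "h i" and h' = "h (Suc i)"])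
         (use Suc.prems(1) y in \<open>auto intro: h\<close>)
    show "norm (barnes_S N (h (Suc i)) b y) \<le> B * (\<Prod>j=1..N. b j)"
    proof (rule Suc.IH[OF _ y])
      show "norm (h (Suc i + N) (y + of_real (b 0) + of_real x)) \<le> B" if "0 \<le> x" "x \<le> (\<Sum>j=1..N. b j)" for x
        using Suc.prems(3)[of "t + x"] t that unfolding sum_Suc by (simp add: add_ac)
    qed (use Suc.prems(1) in auto)
  qed (auto simp: S_def)
  thus ?case using c by (simp add: barnes_S_Suc c_def)
qed

text \<open>Comparing \<open>q\<close> with 0 is one more difference, worth one more derivative and
  a factor \<open>norm q\<close>. This extra power of decay is what admits the case
  \<open>M = N\<close>.\<close>

lemma diff_barnes_S_powr_bound:
  assumes b: "\<forall>j\<in>{0..N}. b j > 0" and q: "q + of_real (b 0) \<in> slit_plane"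
    and K: "compact K" "\<And>s. s \<in> K \<Longrightarrow> \<tau> \<le> Re s"
  obtains C where "\<And>s x. s \<in> K \<Longrightarrow> 0 \<le> x \<Longrightarrow>
    norm (barnes_S N (powr_deriv s 0) b (q + of_real x) - barnes_S N (powr_deriv s 0) b (of_real x))
      \<le> C * (1 + x) powr (- (\<tau> + real (Suc N)))"
proof -
  define S where "S = closed_segment (of_real (b 0)) (q + of_real (b 0))"
  have S_slit: "S \<subseteq> slit_plane" unfolding S_def using b q by (intro closed_segment_subset_slit_plane) auto
  \<comment> \<open>All points at which a derivative is evaluated, up to the shift by
    \<open>x\<close>: a point between \<open>b 0\<close> and \<open>q + b 0\<close>, moved by at
    most the sum of the steps.\<close>
  define K2 where "K2 = (\<lambda>(w, x). w + complex_of_real x) ` (S \<times> {0..\<Sum>j=1..N. b j})"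
  have K2: "compact K2" "K2 \<subseteq> slit_plane"
    unfolding K2_def using S_slit by (intro compact_add_reals add_reals_subset_slit_plane; simp add: S_def)+
  obtain C where C: "C \<ge> 0" "\<And>s w x. s \<in> K \<Longrightarrow> w \<in> K2 \<Longrightarrow> 0 \<le> x \<Longrightarrow>
      norm (powr_deriv s (Suc N) (w + of_real x)) \<le> C * (1 + x) powr (- (\<tau> + real (Suc N)))"
    using powr_deriv_shift_bound[OF K(1) K2 K(2), of "Suc N"] by blast
  show thesis
  proof
    fix s :: complex and x :: real assume s: "s \<in> K" and x: "0 \<le> x"
    define B where "B = C * (1 + x) powr (- (\<tau> + real (Suc N)))"
    have "norm (barnes_S N (powr_deriv s 0) b (q + of_real x) - barnes_S N (powr_deriv s 0) b (of_real x))
        \<le> (B * (\<Prod>j=1..N. b j)) * norm ((q + of_real x) - of_real x)"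
    proof (rule field_differentiable_bound[where S = "closed_segment (of_real x) (q + of_real x)"])
      fix y assume "y \<in> closed_segment (of_real x) (q + of_real x)"
      then obtain u where u: "0 \<le> u" "u \<le> 1" "y = (1 - u) *\<^sub>R of_real x + u *\<^sub>R (q + of_real x)"
        by (auto simp: closed_segment_def)
      define p where "p = (1 - u) *\<^sub>R of_real (b 0) + u *\<^sub>R (q + of_real (b 0))"
      have p: "p \<in> S" unfolding S_def closed_segment_def p_def using u by auto
      have yp: "y + of_real (b 0) = p + of_real x"
        unfolding u(3) p_def by (simp add: scaleR_conv_of_real algebra_simps)
      have y: "y + of_real (b 0) \<in> slit_plane" unfolding yp using p S_slit x by (intro slit_plane_add) auto
      show "(barnes_S N (powr_deriv s 0) b has_field_derivative barnes_S N (powr_deriv s (Suc 0)) b y)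
          (at y within closed_segment (of_real x) (q + of_real x))"
        by (rule has_field_derivative_at_within,
            rule has_field_derivative_barnes_S[where h = "powr_deriv s 0" and h' = "powr_deriv s (Suc 0)"])
           (use b y in \<open>auto intro: has_field_derivative_powr_deriv\<close>)
      show "norm (barnes_S N (powr_deriv s (Suc 0)) b y) \<le> B * (\<Prod>j=1..N. b j)"
      proof (rule norm_barnes_S_le[where h = "powr_deriv s" and i = "Suc 0"])
        fix t assume t: "0 \<le> t" "t \<le> (\<Sum>j=1..N. b j)"
        have "p + of_real t \<in> K2" unfolding K2_def using p t by force
        moreover have "y + of_real (b 0) + of_real t = (p + of_real t) + of_real x" unfolding yp by simp
        ultimately show "norm (powr_deriv s (Suc 0 + N) (y + of_real (b 0) + of_real t)) \<le> B"
          using C(2)[OF s _ x] unfolding B_def by (metis add_Suc add_0)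
      qed (use b y in \<open>auto intro: has_field_derivative_powr_deriv\<close>)
    qed auto
    thus "norm (barnes_S N (powr_deriv s 0) b (q + of_real x) - barnes_S N (powr_deriv s 0) b (of_real x))
      \<le> C * (\<Prod>j=1..N. b j) * norm q * (1 + x) powr (- (\<tau> + real (Suc N)))" by (simp add: B_def mult_ac)
  qed
qed

lemma has_sum_barnes_S_powr:
  assumes a: "\<forall>i\<in>{1..M}. a i > 0" and b: "\<forall>j\<in>{1..N}. b j > 0"
    and z: "z + of_real (b 0) \<in> slit_plane" and s: "Re s > real M"
  shows "((\<lambda>n. barnes_S N (powr_deriv s 0) b (z + of_real (barnes_Omega M a n))) has_sum
           barnes_S N (barnes_zeta_series M a s) b z) (multi_indices M)"
  unfolding barnes_S_def
proof (intro has_sum_finite_sum has_sum_cmult_right)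
  fix J assume "J \<in> Pow {1..N}"
  hence "z + of_real (b 0 + (\<Sum>j\<in>J. b j)) \<in> slit_plane" using b z by (intro slit_plane_add_sum) auto
  from has_sum_powr_deriv[OF a s this, of 0]
  show "((\<lambda>n. powr_deriv s 0 (z + of_real (barnes_Omega M a n) + of_real (b 0 + (\<Sum>j\<in>J. b j)))) has_sum
          barnes_zeta_series M a s (z + of_real (b 0 + (\<Sum>j\<in>J. b j)))) (multi_indices M)"
    by (simp add: add_ac)
qed

lemma barnes_S_cmult: "barnes_S N (\<lambda>w. c * h w) b z = c * barnes_S N h b z"
  by (simp add: barnes_S_def sum_distrib_left mult_ac)

lemma barnes_S_param_holomorphic:
  assumes b: "\<forall>j\<in>{1..N}. b j > 0" and z: "z + of_real (b 0) \<in> slit_plane"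
    and h: "\<And>w. w \<in> slit_plane \<Longrightarrow> (\<lambda>s. h s w) holomorphic_on S"
  shows "(\<lambda>s. barnes_S N (h s) b z) holomorphic_on S"
  unfolding barnes_S_def using slit_plane_add_sum[OF b _ z]
  by (intro holomorphic_intros h) auto

lemma barnes_S_param_derivative:
  assumes b: "\<forall>j\<in>{1..N}. b j > 0" and z: "z + of_real (b 0) \<in> slit_plane"
    and h: "\<And>w. w \<in> slit_plane \<Longrightarrow> ((\<lambda>s. h s w) has_field_derivative h' w) (at s0)"
  shows "((\<lambda>s. barnes_S N (h s) b z) has_field_derivative barnes_S N h' b z) (at s0)"
  unfolding barnes_S_def using slit_plane_add_sum[OF b _ z]
  by (intro DERIV_sum DERIV_cmult h) auto

text \<open>The \<open>(N + 1)\<close>-fold difference \<open>\<S>\<^sub>N \<zeta>\<^sub>M(s, \<cdot>)(q) - \<S>\<^sub>N \<zeta>\<^sub>M(s, \<cdot>)(0)\<close> is given by its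
  Dirichlet series for \<open>Re s > M - N - 1\<close>, hence near \<open>s = 0\<close>.\<close>

lemma tendsto_sum_diff_barnes_S_Ln:
  assumes MN: "M \<le> N" and a: "\<forall>i\<in>{1..M}. a i > 0" and b: "\<forall>j\<in>{0..N}. b j > 0"
    and q: "q + of_real (b 0) \<in> slit_plane"
  shows "((\<lambda>F. \<Sum>n\<in>F. barnes_S N (\<lambda>w. - Ln w) b (q + of_real (barnes_Omega M a n)) -
                      barnes_S N (\<lambda>w. - Ln w) b (of_real (barnes_Omega M a n)))
           \<longlongrightarrow> barnes_S N (barnes_L M a) b q - barnes_S N (barnes_L M a) b 0)
         (finite_subsets_at_top (multi_indices M))"
proof -
  note nonneg = barnes_Omega_nonneg[OF a]
  have b': "\<forall>j\<in>{1..N}. b j > 0" and b0: "b 0 > 0" using b by auto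
  have zero: "0 + of_real (b 0) \<in> slit_plane" using b0 by (simp add: complex_nonpos_Reals_iff)
  obtain E where E: "\<And>\<sigma>. barnes_cont M a \<sigma> E" using barnes_cont_exists[OF a] by blast
  have E_hol: "(\<lambda>s. E s w) holomorphic_on {s. Re s > -1}" if "w \<in> slit_plane" for w
    using barnes_cont_holomorphic[OF E _ that, of "-1" "-1"] by simp
  define P where "P = (\<lambda>s. pochhammer (s - of_nat M) M :: complex)"
  have P0: "P s \<noteq> 0" if "Re s < 1 \<or> Re s > real M" for s
    unfolding P_def using that by (rule pochhammer_shift_neq_0)
  have P_hol: "P holomorphic_on S" for S unfolding P_def by (intro holomorphic_intros)
  define \<Delta> where "\<Delta> = (\<lambda>n s. barnes_S N (powr_deriv s 0) b (q + of_real (barnes_Omega M a n)) -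
      barnes_S N (powr_deriv s 0) b (of_real (barnes_Omega M a n)))"
  define T where "T = (\<lambda>s. \<Sum>\<^sub>\<infinity>n\<in>multi_indices M. \<Delta> n s)"
  \<comment> \<open>The series converges for \<open>Re s > M - N - 1\<close>, and
    \<open>M \<le> N\<close> puts this bound at -1 or below, so \<open>H\<close> is admissible and
    contains 0.\<close>
  define H where "H = {s. Re s > -1}"
  have H: "open H" "0 \<in> H" unfolding H_def by (auto simp: open_halfspace_Re_gt)
  have slit: "q + of_real (barnes_Omega M a n) + of_real (b 0) \<in> slit_plane"
             "of_real (barnes_Omega M a n) + of_real (b 0) \<in> slit_plane" for n
    using slit_plane_add[OF q nonneg[of n]] slit_plane_add[OF zero nonneg[of n]] by (auto simp: add_ac)
  have \<Delta>_hol: "\<Delta> n holomorphic_on H" for n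
    unfolding \<Delta>_def using slit[of n] by (intro holomorphic_on_diff barnes_S_param_holomorphic b' powr_deriv_holomorphic(1)) auto
  have bound: "\<exists>g. g summable_on multi_indices M \<and> (\<forall>n\<in>multi_indices M. \<forall>s\<in>K. norm (\<Delta> n s) \<le> g n)"
    if K: "compact K" "K \<subseteq> H" for K
  proof (cases "K = {}")
    case False
    obtain s0 where s0: "s0 \<in> K" "\<And>s. s \<in> K \<Longrightarrow> Re s0 \<le> Re s"
      using continuous_attains_inf[OF K(1) False, of Re] continuous_on_Re[OF continuous_on_id] by auto
    obtain C where C: "\<And>s x. s \<in> K \<Longrightarrow> 0 \<le> x \<Longrightarrow>
      norm (barnes_S N (powr_deriv s 0) b (q + of_real x) - barnes_S N (powr_deriv s 0) b (of_real x))
        \<le> C * (1 + x) powr (- (Re s0 + real (Suc N)))"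
      using diff_barnes_S_powr_bound[OF b q K(1) s0(2)] by blast
    have "Re s0 + real (Suc N) > real M" using s0(1) K(2) MN by (auto simp: H_def)
    hence "(\<lambda>n. C * (1 + barnes_Omega M a n) powr (- (Re s0 + real (Suc N)))) summable_on multi_indices M"
      by (intro summable_on_cmult_right summable_barnes_Omega_powr a)
    thus ?thesis using C nonneg unfolding \<Delta>_def by blast
  qed (auto intro!: exI[of _ "\<lambda>_. 0"])
  have T_hol: "T holomorphic_on H"
    unfolding T_def by (rule infsum_holomorphic(1)[OF H(1)]) (use \<Delta>_hol bound in auto)
  \<comment> \<open>Stated with the factor \<open>P\<close>, because the possible poles
    \<open>1, ..., M\<close> lie between 0 and the half-plane where the zeta series converges.
    Division by \<open>P\<close> waits until \<open>s\<close> is near 0.\<close>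
  have PT: "P s * T s = barnes_S N (E s) b q - barnes_S N (E s) b 0" if "s \<in> H" for s
  proof (rule holomorphic_eq_halfplane[where f = "\<lambda>s. P s * T s" and s = s and \<sigma> = "-1" and r = "real M" and
        g = "\<lambda>s. barnes_S N (E s) b q - barnes_S N (E s) b 0"])
    show "(\<lambda>s. P s * T s) holomorphic_on {s. Re s > -1}"
      using T_hol P_hol by (intro holomorphic_intros) (auto simp: H_def)
    show "(\<lambda>s. barnes_S N (E s) b q - barnes_S N (E s) b 0) holomorphic_on {s. Re s > -1}"
      using q zero E_hol by (intro holomorphic_on_diff barnes_S_param_holomorphic b') auto
    fix s :: complex assume s: "Re s > real M"
    have E_eq: "barnes_S N (E s) b z = P s * barnes_S N (barnes_zeta_series M a s) b z"
      if "z + of_real (b 0) \<in> slit_plane" for z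
      unfolding barnes_S_cmult[symmetric]
      using E[of 0] s slit_plane_add_sum[OF b' _ that] by (intro barnes_S_cong) (auto simp: barnes_cont_def P_def)
    have "T s = barnes_S N (barnes_zeta_series M a s) b q - barnes_S N (barnes_zeta_series M a s) b 0"
      unfolding T_def \<Delta>_def
      using has_sum_add[OF has_sum_barnes_S_powr[OF a b' q s] has_sum_uminusI[OF has_sum_barnes_S_powr[OF a b' zero s]]]
      by (intro infsumI) simp
    thus "P s * T s = barnes_S N (E s) b q - barnes_S N (E s) b 0"
      using E_eq[OF q] E_eq[OF zero] by (simp add: right_diff_distrib)
  qed (use that in \<open>auto simp: H_def\<close>)
  have L: "((\<lambda>s. E s w / P s) has_field_derivative barnes_L M a w) (at 0)" if "w \<in> slit_plane" for w
  proof -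
    have "(\<lambda>s. E s w / P s) holomorphic_on ({s. Re s > -1} \<inter> {s. Re s < 1})"
      using P0 E_hol[OF that] P_hol by (intro holomorphic_intros) (auto intro: holomorphic_on_subset)
    hence "((\<lambda>s. E s w / P s) has_field_derivative deriv (\<lambda>s. E s w / P s) 0) (at 0)"
      by (rule holomorphic_derivI) (auto intro: open_halfspace_Re_gt open_halfspace_Re_lt)
    thus ?thesis using barnes_L_eq[OF E that] by (simp add: P_def)
  qed
  have "deriv T 0 = deriv (\<lambda>s. barnes_S N (\<lambda>w. E s w / P s) b q - barnes_S N (\<lambda>w. E s w / P s) b 0) 0"
  proof (rule deriv_cong_ev)
    have "\<forall>\<^sub>F s in nhds (0::complex). s \<in> {s. Re s > -1} \<inter> {s. Re s < 1}"
      by (intro eventually_nhds_in_open) (auto intro: open_halfspace_Re_gt open_halfspace_Re_lt)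
    thus "\<forall>\<^sub>F s in nhds 0. T s = barnes_S N (\<lambda>w. E s w / P s) b q - barnes_S N (\<lambda>w. E s w / P s) b 0"
    proof eventually_elim
      case (elim s)
      hence "P s \<noteq> 0" "s \<in> H" using P0 by (auto simp: H_def)
      hence "T s = (1 / P s) * (barnes_S N (E s) b q - barnes_S N (E s) b 0)" by (simp flip: PT)
      thus ?case by (simp add: right_diff_distrib flip: barnes_S_cmult)
    qed
  qed simp
  also have "\<dots> = barnes_S N (barnes_L M a) b q - barnes_S N (barnes_L M a) b 0"
    using q zero L by (intro DERIV_imp_deriv DERIV_diff barnes_S_param_derivative b') auto
  finally have deriv_T: "deriv T 0 = barnes_S N (barnes_L M a) b q - barnes_S N (barnes_L M a) b 0" .
  have deriv_\<Delta>: "deriv (\<Delta> n) 0 = barnes_S N (\<lambda>w. - Ln w) b (q + of_real (barnes_Omega M a n)) -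
                      barnes_S N (\<lambda>w. - Ln w) b (of_real (barnes_Omega M a n))" for n
  proof -
    have "((\<lambda>s. powr_deriv s 0 w) has_field_derivative - Ln w) (at 0)" if "w \<in> slit_plane" for w
    proof -
      have "w \<noteq> 0" using that by auto
      thus ?thesis by (auto simp: powr_def intro!: derivative_eq_intros)
    qed
    thus ?thesis unfolding \<Delta>_def
      by (intro DERIV_imp_deriv DERIV_diff barnes_S_param_derivative b' slit)
  qed
  have "((\<lambda>F. \<Sum>n\<in>F. deriv (\<Delta> n) 0) \<longlongrightarrow> deriv T 0) (finite_subsets_at_top (multi_indices M))"
    unfolding T_def by (rule infsum_holomorphic(2)[OF H(1) _ _ H(2)]) (use \<Delta>_hol bound in auto)
  thus ?thesis by (simp only: deriv_\<Delta> deriv_T)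
qed

section \<open>From logarithms to the factors of the product\<close>

text \<open>Each principal logarithm is exponentiated separately, so no branches have to be
  combined. The extra 1 in the exponent of the sign comes from \<open>- Ln\<close>.\<close>

lemma exp_diff_barnes_S_Ln:
  assumes b: "\<forall>j\<in>{0..N}. b j > 0" and x: "x \<ge> 0" and q: "q + of_real (b 0) \<in> slit_plane"
  shows "exp (barnes_S N (\<lambda>w. - Ln w) b (q + of_real x) - barnes_S N (\<lambda>w. - Ln w) b (of_real x)) =
    (\<Prod>J\<in>Pow {1..N}. ((q + of_real (b 0 + (\<Sum>j\<in>J. b j) + x)) / of_real (b 0 + (\<Sum>j\<in>J. b j) + x))
       powi ((-1) ^ (card J + 1)))"
proof -
  have b': "\<forall>j\<in>{1..N}. b j > 0" and zero: "0 + of_real (b 0) \<in> slit_plane"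
    using b by (auto simp: complex_nonpos_Reals_iff not_le)
  have eq: "barnes_S N (\<lambda>w. - Ln w) b (q + of_real x) - barnes_S N (\<lambda>w. - Ln w) b (of_real x) =
    (\<Sum>J\<in>Pow {1..N}. (-1) ^ (card J + 1) * (Ln (q + of_real (b 0 + (\<Sum>j\<in>J. b j) + x)) - Ln (of_real (b 0 + (\<Sum>j\<in>J. b j) + x))))"
    unfolding barnes_S_def sum_subtractf[symmetric] by (intro sum.cong refl) (simp add: algebra_simps)
  have "exp (barnes_S N (\<lambda>w. - Ln w) b (q + of_real x) - barnes_S N (\<lambda>w. - Ln w) b (of_real x)) = (\<Prod>J\<in>Pow {1..N}. exp ((-1) ^ (card J + 1) * (Ln (q + of_real (b 0 + (\<Sum>j\<in>J. b j) + x)) - Ln (of_real (b 0 + (\<Sum>j\<in>J. b j) + x)))))"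
    unfolding eq by (rule exp_sum) auto
  also have "\<dots> = (\<Prod>J\<in>Pow {1..N}. ((q + of_real (b 0 + (\<Sum>j\<in>J. b j) + x)) / of_real (b 0 + (\<Sum>j\<in>J. b j) + x))
       powi ((-1) ^ (card J + 1)))"
  proof (intro prod.cong refl)
    fix J assume J: "J \<in> Pow {1..N}"
    define u v :: complex where "u = q + of_real (b 0 + (\<Sum>j\<in>J. b j) + x)" and "v = of_real (b 0 + (\<Sum>j\<in>J. b j) + x)"
    have "u \<in> slit_plane" "v \<in> slit_plane"
      using slit_plane_add[OF slit_plane_add_sum[OF b' _ q] x, of J] slit_plane_add[OF slit_plane_add_sum[OF b' _ zero] x, of J] J
      by (auto simp: u_def v_def add_ac)
    hence nz: "u \<noteq> 0" "v \<noteq> 0" by auto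
    show "exp ((-1) ^ (card J + 1) * (Ln u - Ln v)) = (u / v) powi ((-1) ^ (card J + 1))"
      using nz by (cases "even (card J)") (simp_all add: exp_diff exp_minus power_int_minus)
  qed
  finally show ?thesis .
qed

lemma barnes_factor_eq_exp:
  assumes "\<forall>i\<in>{1..M}. a i > 0" "\<forall>j\<in>{0..N}. b j > 0" "q + of_real (b 0) \<in> slit_plane"
  shows "barnes_factor M N a b q n = exp (barnes_S N (\<lambda>w. - Ln w) b (q + of_real (barnes_Omega M a n)) -
                      barnes_S N (\<lambda>w. - Ln w) b (of_real (barnes_Omega M a n)))"
  using exp_diff_barnes_S_Ln[OF assms(2) barnes_Omega_nonneg[OF assms(1)] assms(3)]
  by (simp add: barnes_factor_def)

lemma tendsto_prod_barnes_factor: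
  assumes "M \<le> N" "\<forall>i\<in>{1..M}. a i > 0" "\<forall>j\<in>{0..N}. b j > 0" "q + of_real (b 0) \<in> slit_plane"
  shows "((\<lambda>F. \<Prod>n\<in>F. barnes_factor M N a b q n) \<longlongrightarrow> barnes_eta M N a b q)
           (finite_subsets_at_top (multi_indices M))"
proof -
  have "((\<lambda>F. exp (\<Sum>n\<in>F. barnes_S N (\<lambda>w. - Ln w) b (q + of_real (barnes_Omega M a n)) -
                      barnes_S N (\<lambda>w. - Ln w) b (of_real (barnes_Omega M a n)))) \<longlongrightarrow> barnes_eta M N a b q)
           (finite_subsets_at_top (multi_indices M))"
    unfolding barnes_eta_def by (intro tendsto_exp tendsto_sum_diff_barnes_S_Ln assms)
  thus ?thesis
  proof (rule Lim_transform_eventually)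
    show "\<forall>\<^sub>F F in finite_subsets_at_top (multi_indices M).
        exp (\<Sum>n\<in>F. barnes_S N (\<lambda>w. - Ln w) b (q + of_real (barnes_Omega M a n)) -
                      barnes_S N (\<lambda>w. - Ln w) b (of_real (barnes_Omega M a n))) = (\<Prod>n\<in>F. barnes_factor M N a b q n)"
      by (rule eventually_finite_subsets_at_top_weakI) (simp add: exp_sum barnes_factor_eq_exp[OF assms(2-4)])
  qed
qed

text \<open>Without periods the log-gamma function is \<open>- Ln\<close>, and adding \<Omega> to
  \<open>b 0\<close> is the same as shifting the argument. Hence each factor of the product is
  itself the Mellin transform of a Barnes beta law.\<close>

lemma barnes_eta_0_eq_factor:
  assumes "\<forall>i\<in>{1..M}. a i > 0" "\<forall>j\<in>{0..N}. b j > 0" "q + of_real (b 0) \<in> slit_plane"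
  shows "barnes_eta 0 N a (b(0 := b 0 + barnes_Omega M a n)) q = barnes_factor M N a b q n"
proof -
  have "barnes_S N (barnes_L 0 a) (b(0 := b 0 + barnes_Omega M a n)) z =
        barnes_S N (\<lambda>w. - Ln w) b (z + of_real (barnes_Omega M a n))" for z
  proof (rule barnes_S_cong)
    fix J :: "nat set" assume "J \<subseteq> {1..N}"
    hence "(\<Sum>j\<in>J. (b(0 := b 0 + barnes_Omega M a n)) j) = (\<Sum>j\<in>J. b j)" by (intro sum.cong refl) auto
    thus "barnes_L 0 a (z + of_real ((b(0 := b 0 + barnes_Omega M a n)) 0 + (\<Sum>j\<in>J. (b(0 := b 0 + barnes_Omega M a n)) j))) =
         - Ln (z + of_real (barnes_Omega M a n) + of_real (b 0 + (\<Sum>j\<in>J. b j)))"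
      by (simp only:) (simp add: barnes_L_def add_ac)
  qed
  thus ?thesis by (simp add: barnes_eta_def barnes_factor_eq_exp[OF assms])
qed

subsection \<open>The product of independent Barnes beta variables\<close>

lemma borel_measurable_of_real_powr [measurable]:
  "(\<lambda>x::real. complex_of_real x powr q) \<in> borel_measurable borel"
proof -
  have "(\<lambda>x::real. complex_of_real x powr q) =
     (\<lambda>x. if x = 0 then 0 else exp (q * (of_real (ln \<bar>x\<bar>) + (if x < 0 then pi else 0) * \<i>)))"
    by (rule ext) (simp add: powr_def Ln_of_real')
  thus ?thesis by simp
qed

lemma prod_of_real_powr:
  assumes "\<And>i. i \<in> F \<Longrightarrow> u i > (0::real)"
  shows "(\<Prod>i\<in>F. complex_of_real (u i) powr q) = complex_of_real (\<Prod>i\<in>F. u i) powr q"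
  using assms
proof (induction F rule: infinite_finite_induct)
  case (insert i F)
  hence "complex_of_real (u i * prod u F) powr q = complex_of_real (u i) powr q * complex_of_real (prod u F) powr q"
    unfolding of_real_mult by (intro powr_times_real) (auto intro!: prod_nonneg simp: less_imp_le simp flip: of_real_prod)
  with insert show ?case by simp
qed auto

lemma prod_le_prod_subset:
  fixes u :: "'i \<Rightarrow> real"
  assumes "finite G" "G0 \<subseteq> G" "\<And>i. i \<in> G \<Longrightarrow> 0 \<le> u i \<and> u i \<le> 1"
  shows "prod u G \<le> prod u G0"
proof -
  have "prod u G = prod u (G - G0) * prod u G0" using assms by (intro prod.subset_diff) auto
  also have "\<dots> \<le> 1 * prod u G0"
    using assms by (intro mult_right_mono prod_le_1 prod_nonneg) (auto intro: prod_nonneg)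
  finally show ?thesis by simp
qed

text \<open>Finite products decrease as the index set grows, so the net converges to their
  infimum.\<close>

lemma prod_unit_interval_convergent:
  fixes u :: "'i \<Rightarrow> real"
  assumes u: "\<And>i. i \<in> I \<Longrightarrow> 0 \<le> u i \<and> u i \<le> 1"
  shows "\<exists>L. (prod u \<longlongrightarrow> L) (finite_subsets_at_top I)"
proof
  define A where "A = prod u ` {G. finite G \<and> G \<subseteq> I}"
  have nonneg: "0 \<le> prod u G" if "G \<subseteq> I" for G using u that by (intro prod_nonneg) auto
  have bdd: "bdd_below A" unfolding A_def using nonneg by (intro bdd_belowI[of _ 0]) auto
  have ne: "A \<noteq> {}" unfolding A_def by auto
  show "(prod u \<longlongrightarrow> Inf A) (finite_subsets_at_top I)"
  proof (rule decreasing_tendsto)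
    show "\<forall>\<^sub>F G in finite_subsets_at_top I. Inf A \<le> prod u G"
      by (rule eventually_finite_subsets_at_top_weakI) (auto simp: A_def intro!: cInf_lower bdd[unfolded A_def])
    fix x assume "Inf A < x"
    then obtain G0 where G0: "finite G0" "G0 \<subseteq> I" "prod u G0 < x"
      using cInf_lessD[OF ne] by (auto simp: A_def)
    show "\<forall>\<^sub>F G in finite_subsets_at_top I. prod u G < x"
      unfolding eventually_finite_subsets_at_top
    proof (intro exI[of _ G0] conjI allI impI G0)
      fix G assume "finite G \<and> G0 \<subseteq> G \<and> G \<subseteq> I"
      hence "prod u G \<le> prod u G0" using u by (intro prod_le_prod_subset) auto
      thus "prod u G < x" using G0 by linarith
    qed
  qed
qed

text \<open>Monotone and dominated convergence work along sequences, whereas the infinite products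
  are limits over the net of finite subsets; composing with \<open>F\<close> passes from the latter
  to the former.\<close>

lemma countable_exhaustion:
  assumes "countable I"
  obtains F :: "nat \<Rightarrow> 'i set" where "incseq F" "\<And>k. finite (F k)" "\<And>k. F k \<subseteq> I"
    "filterlim F (finite_subsets_at_top I) sequentially"
proof
  define F where "F = (\<lambda>k. {i \<in> I. to_nat_on I i < k})"
  show "incseq F" by (auto simp: F_def incseq_def)
  show fin: "finite (F k)" for k
  proof (rule finite_imageD[where f = "to_nat_on I"])
    show "finite (to_nat_on I ` F k)" by (rule finite_subset[of _ "{..<k}"]) (auto simp: F_def)
    show "inj_on (to_nat_on I) (F k)"
      using assms by (intro inj_on_subset[OF inj_on_to_nat_on[of I]]) (auto simp: F_def)
  qed
  show "F k \<subseteq> I" for k by (auto simp: F_def)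
  show "filterlim F (finite_subsets_at_top I) sequentially"
    unfolding filterlim_finite_subsets_at_top
  proof safe
    fix X assume X: "finite X" "X \<subseteq> I"
    define m where "m = Suc (Max (to_nat_on I ` X))"
    have "to_nat_on I i < m" if "i \<in> X" for i
      unfolding m_def using X that by (auto simp: less_Suc_eq_le)
    thus "\<forall>\<^sub>F k in sequentially. finite (F k) \<and> X \<subseteq> F k \<and> F k \<subseteq> I"
      using fin X by (intro eventually_sequentiallyI[of m]) (force simp: F_def)
  qed
qed

text \<open>The Mellin transform on the imaginary axis is the characteristic function of the logarithm.\<close>

lemma barnes_beta_law_unique:
  assumes "b 0 > 0" "barnes_beta_law M N a b D1" "barnes_beta_law M N a b D2"
  shows "D1 = D2"
proof -
  have main: "real_distribution (distr D borel ln)"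
      "char (distr D borel ln) = (\<lambda>t. barnes_eta M N a b (\<i> * of_real t))"
      "distr (distr D borel ln) borel exp = D"
    if D: "barnes_beta_law M N a b D" for D
  proof -
    interpret D: prob_space D using D by (simp add: barnes_beta_law_def)
    have sets [measurable_cong]: "sets D = sets borel" using D by (simp add: barnes_beta_law_def)
    have pos: "AE x in D. x > 0" using D by (auto simp: barnes_beta_law_def)
    show "real_distribution (distr D borel ln)" by (intro D.real_distribution_distr) measurable
    show "char (distr D borel ln) = (\<lambda>t. barnes_eta M N a b (\<i> * of_real t))"
    proof
      fix t
      have "char (distr D borel ln) t = (\<integral>x. iexp (t * ln x) \<partial>D)"
        unfolding char_def by (subst integral_distr) auto
      also have "\<dots> = (\<integral>x. complex_of_real x powr (\<i> * of_real t) \<partial>D)"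
      proof (rule integral_cong_AE)
        show "AE x in D. iexp (t * ln x) = complex_of_real x powr (\<i> * of_real t)"
          using pos by eventually_elim (simp add: powr_def Ln_of_real mult_ac)
      qed measurable
      also have "\<dots> = barnes_eta M N a b (\<i> * of_real t)"
        using D assms(1) by (intro has_bochner_integral_integral_eq) (auto simp: barnes_beta_law_def)
      finally show "char (distr D borel ln) t = barnes_eta M N a b (\<i> * of_real t)" .
    qed
    \<comment> \<open>Since \<open>D\<close> lives on the positive reals, \<open>exp\<close> undoes
      \<open>ln\<close> almost everywhere and the law can be recovered from that of the
      logarithm.\<close>
    have "distr (distr D borel ln) borel exp = distr D borel (\<lambda>x. exp (ln x))"
      by (subst distr_distr) (auto simp: o_def)
    also have "\<dots> = distr D borel (\<lambda>x. x)"
      using pos by (intro distr_cong_AE) (auto elim: eventually_mono)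
    also have "\<dots> = D" by (rule distr_id2) (simp add: sets)
    finally show "distr (distr D borel ln) borel exp = D" .
  qed
  have "distr D1 borel ln = distr D2 borel ln"
    using main[OF assms(2)] main[OF assms(3)] by (intro Levy_uniqueness) auto
  thus ?thesis using main(3)[OF assms(2)] main(3)[OF assms(3)] by metis
qed

lemma barnes_beta_product:
  fixes P :: "'p measure" and X :: "(nat \<Rightarrow> nat) \<Rightarrow> 'p \<Rightarrow> real"
  assumes MN: "M \<le> N" and a: "\<forall>i\<in>{1..M}. a i > 0" and b: "\<forall>j\<in>{0..N}. b j > 0"
    and P: "prob_space P" and indep: "prob_space.indep_vars P (\<lambda>_. borel) X (multi_indices M)"
    and law: "\<forall>n\<in>multi_indices M.
           barnes_beta_law 0 N a (b(0 := b 0 + barnes_Omega M a n)) (distr P borel (X n))"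
  shows "\<exists>Y. Y \<in> borel_measurable P \<and>
           (AE x in P. ((\<lambda>F. \<Prod>n\<in>F. X n x) \<longlongrightarrow> Y x) (finite_subsets_at_top (multi_indices M))) \<and>
           barnes_beta_law M N a b (distr P borel Y)"
proof -
  interpret P: prob_space P by (rule P)
  define I where "I = multi_indices M"
  have b0: "b 0 > 0" using b by simp
  have X_meas [measurable]: "X n \<in> borel_measurable P" if "n \<in> I" for n
    using indep that by (auto simp: P.indep_vars_def I_def)
  have X_unit: "AE x in P. \<forall>n\<in>I. 0 < X n x \<and> X n x \<le> 1"
  proof (subst AE_ball_countable)
    show "countable I" unfolding I_def by (rule countable_multi_indices)
    show "\<forall>n\<in>I. AE x in P. 0 < X n x \<and> X n x \<le> 1"
    proof
      fix n assume n: "n \<in> I"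
      have "AE y in distr P borel (X n). 0 < y \<and> y \<le> 1"
        using law n by (auto simp: barnes_beta_law_def I_def)
      thus "AE x in P. 0 < X n x \<and> X n x \<le> 1" using n by (subst (asm) AE_distr_iff) auto
    qed
  qed
  have slit: "q + of_real (b 0) \<in> slit_plane" if "Re q > - b 0" for q
    using that by (auto simp: complex_nonpos_Reals_iff)
  have mellin_X: "has_bochner_integral P (\<lambda>x. complex_of_real (X n x) powr q) (barnes_factor M N a b q n)"
    if n: "n \<in> I" and q: "Re q > - b 0" for n q
  proof -
    have "has_bochner_integral (distr P borel (X n)) (\<lambda>x. complex_of_real x powr q)
            (barnes_eta 0 N a (b(0 := b 0 + barnes_Omega M a n)) q)"
      using law n q barnes_Omega_nonneg[OF a, of n] by (auto simp: barnes_beta_law_def I_def)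
    thus ?thesis
      using n barnes_eta_0_eq_factor[OF a b slit[OF q]]
      by (simp add: has_bochner_integral_iff integrable_distr_eq integral_distr)
  qed
  obtain F :: "nat \<Rightarrow> (nat \<Rightarrow> nat) set" where F: "incseq F" "\<And>k. finite (F k)" "\<And>k. F k \<subseteq> I"
    "filterlim F (finite_subsets_at_top I) sequentially"
    using countable_exhaustion[OF countable_multi_indices[of M, folded I_def]] by metis
  \<comment> \<open>A version of \<open>X\<close> whose values lie in the unit interval everywhere,
    so that monotonicity and convergence of the partial products hold at every point.\<close>
  define Z where "Z = (\<lambda>n x. if 0 < X n x \<and> X n x \<le> 1 then X n x else 1)"
  have Z_meas [measurable]: "Z n \<in> borel_measurable P" if "n \<in> I" for n
    using that unfolding Z_def by measurable
  have Z: "0 < Z n x" "Z n x \<le> 1" for n x by (auto simp: Z_def)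
  have Z_eq: "AE x in P. \<forall>n\<in>I. Z n x = X n x" using X_unit by eventually_elim (auto simp: Z_def)
  define U where "U = (\<lambda>k x. \<Prod>n\<in>F k. Z n x)"
  have U_meas [measurable]: "U k \<in> borel_measurable P" for k
    unfolding U_def using F(3)[of k] by (intro borel_measurable_prod Z_meas) auto
  have U: "0 < U k x" "U k x \<le> 1" for k x
    unfolding U_def using Z by (auto intro!: prod_pos prod_le_1 simp: less_imp_le)
  have U_mono: "U l x \<le> U k x" if "k \<le> l" for k l x
    unfolding U_def using F(2) incseqD[OF F(1) that] Z by (intro prod_le_prod_subset) (auto simp: less_imp_le)
  define Y where "Y = (\<lambda>x. lim (\<lambda>k. U k x))"
  \<comment> \<open>\<open>Y\<close> is a sequential limit, which makes it measurable; here it is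
    matched with the unordered limit demanded by the theorem.\<close>
  have net: "((\<lambda>G. \<Prod>n\<in>G. Z n x) \<longlongrightarrow> Y x) (finite_subsets_at_top I)" for x
  proof -
    obtain L where L: "((\<lambda>G. \<Prod>n\<in>G. Z n x) \<longlongrightarrow> L) (finite_subsets_at_top I)"
      using prod_unit_interval_convergent[of I "\<lambda>n. Z n x"] Z by (auto simp: less_imp_le)
    have "(\<lambda>k. U k x) \<longlonglongrightarrow> L" unfolding U_def using filterlim_compose[OF L F(4)] .
    hence "Y x = L" unfolding Y_def by (rule limI)
    thus ?thesis using L by simp
  qed
  have U_lim: "(\<lambda>k. U k x) \<longlonglongrightarrow> Y x" for x
    unfolding U_def using filterlim_compose[OF net F(4)] .
  have Y_meas [measurable]: "Y \<in> borel_measurable P"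
    by (rule borel_measurable_LIMSEQ_real[OF U_lim U_meas])
  have Y_le: "Y x \<le> U k x" for x k
    by (rule LIMSEQ_le_const2[OF U_lim]) (use U_mono in auto)
  \<comment> \<open>Independence is assumed for \<open>X\<close>, so the integral is factored there
    and carried over to \<open>Z\<close> almost everywhere.\<close>
  have mellin_U: "has_bochner_integral P (\<lambda>x. complex_of_real (U k x) powr q) (\<Prod>n\<in>F k. barnes_factor M N a b q n)"
    if q: "Re q > - b 0" for q k
  proof -
    have "P.indep_vars (\<lambda>_. borel) X (F k)"
      using indep F(3) unfolding I_def by (rule P.indep_vars_subset)
    hence ind: "P.indep_vars (\<lambda>_. borel) (\<lambda>n x. complex_of_real (X n x) powr q) (F k)"
      by (rule P.indep_vars_compose2) measurable
    have int: "integrable P (\<lambda>x. complex_of_real (X n x) powr q)" if "n \<in> F k" for n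
      using mellin_X[OF _ q] F(3)[of k] that by (auto simp: has_bochner_integral_iff)
    have "has_bochner_integral P (\<lambda>x. \<Prod>n\<in>F k. complex_of_real (X n x) powr q)
        (\<Prod>n\<in>F k. \<integral>x. complex_of_real (X n x) powr q \<partial>P)"
      unfolding has_bochner_integral_iff
      using P.indep_vars_integrable[OF F(2) ind int] P.indep_vars_lebesgue_integral[OF F(2) ind int] by simp
    also have "(\<Prod>n\<in>F k. \<integral>x. complex_of_real (X n x) powr q \<partial>P) = (\<Prod>n\<in>F k. barnes_factor M N a b q n)"
      using F(3)[of k] by (intro prod.cong refl has_bochner_integral_integral_eq mellin_X q) auto
    also have "has_bochner_integral P (\<lambda>x. \<Prod>n\<in>F k. complex_of_real (X n x) powr q) (\<Prod>n\<in>F k. barnes_factor M N a b q n)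
      \<longleftrightarrow> has_bochner_integral P (\<lambda>x. complex_of_real (U k x) powr q) (\<Prod>n\<in>F k. barnes_factor M N a b q n)"
    proof (rule has_bochner_integral_cong_AE)
      show "(\<lambda>x. \<Prod>n\<in>F k. complex_of_real (X n x) powr q) \<in> borel_measurable P"
        using int by (intro borel_measurable_prod) auto
      show "AE x in P. (\<Prod>n\<in>F k. complex_of_real (X n x) powr q) = complex_of_real (U k x) powr q"
        using Z_eq
      proof eventually_elim
        case (elim x)
        hence "(\<Prod>n\<in>F k. complex_of_real (X n x) powr q) = (\<Prod>n\<in>F k. complex_of_real (Z n x) powr q)"
          using F(3)[of k] by (intro prod.cong refl) auto
        thus ?case unfolding U_def using Z by (simp only: prod_of_real_powr)
      qed
    qed measurable
    finally show ?thesis .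
  qed
  have lim_factor: "(\<lambda>k. \<Prod>n\<in>F k. barnes_factor M N a b q n) \<longlonglongrightarrow> barnes_eta M N a b q" if "Re q > - b 0" for q
    using filterlim_compose[OF tendsto_prod_barnes_factor[OF MN a b slit[OF that]] F(4)[unfolded I_def]] .
  txt \<open>For negative \<open>\<rho>\<close> the powers \<open>U\<^sub>k\<^sup>\<rho>\<close> increase with bounded means, so their supremum is integrable;
    this provides the dominating function and excludes \<open>Y = 0\<close>.\<close>
  have dom: "\<exists>w. integrable P w \<and> (AE x in P. Y x > 0 \<and> (\<forall>k. U k x powr \<rho> \<le> w x))" if \<rho>: "- b 0 < \<rho>" "\<rho> < 0" for \<rho> :: real
  proof -
    define g where "g = (\<lambda>x. SUP k. ennreal (U k x powr \<rho>))"
    have g_meas [measurable]: "g \<in> borel_measurable P" unfolding g_def by measurable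
    have int: "integrable P (\<lambda>x. U k x powr \<rho>)"
      and int_eq: "complex_of_real (\<integral>x. U k x powr \<rho> \<partial>P) = (\<Prod>n\<in>F k. barnes_factor M N a b (of_real \<rho>) n)" for k
    proof -
      have "complex_of_real (U k x) powr of_real \<rho> = of_real (U k x powr \<rho>)" for x
        using U[of k x] by (simp add: powr_of_real)
      hence "has_bochner_integral P (\<lambda>x. complex_of_real (U k x powr \<rho>)) (\<Prod>n\<in>F k. barnes_factor M N a b (of_real \<rho>) n)"
        using mellin_U[of "of_real \<rho>" k] \<rho> by simp
      thus "integrable P (\<lambda>x. U k x powr \<rho>)"
           "complex_of_real (\<integral>x. U k x powr \<rho> \<partial>P) = (\<Prod>n\<in>F k. barnes_factor M N a b (of_real \<rho>) n)"
        by (auto simp: has_bochner_integral_iff complex_of_real_integrable_eq)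
    qed
    have "convergent (\<lambda>k. complex_of_real (\<integral>x. U k x powr \<rho> \<partial>P))"
      using lim_factor[of "of_real \<rho>"] \<rho> unfolding int_eq convergent_def by auto
    hence "Bseq (\<lambda>k. complex_of_real (\<integral>x. U k x powr \<rho> \<partial>P))" by (rule convergent_imp_Bseq)
    then obtain B where B: "\<And>k. \<bar>\<integral>x. U k x powr \<rho> \<partial>P\<bar> \<le> B" by (auto simp: Bseq_def)
    have "(\<integral>\<^sup>+x. g x \<partial>P) = (SUP k. \<integral>\<^sup>+x. ennreal (U k x powr \<rho>) \<partial>P)"
      unfolding g_def
    proof (rule nn_integral_monotone_convergence_SUP)
      show "incseq (\<lambda>k x. ennreal (U k x powr \<rho>))"
        using \<rho> U U_mono by (auto simp: incseq_def le_fun_def intro!: ennreal_leI powr_mono2')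
    qed measurable
    also have "\<dots> \<le> ennreal B"
    proof (rule SUP_least)
      fix k
      have "(\<integral>\<^sup>+x. ennreal (U k x powr \<rho>) \<partial>P) = ennreal (\<integral>x. U k x powr \<rho> \<partial>P)"
        by (intro nn_integral_eq_integral int) auto
      also have "\<dots> \<le> ennreal B" using B[of k] by (intro ennreal_leI) auto
      finally show "(\<integral>\<^sup>+x. ennreal (U k x powr \<rho>) \<partial>P) \<le> ennreal B" .
    qed
    finally have g_int: "(\<integral>\<^sup>+x. g x \<partial>P) < \<infinity>" by (simp add: le_less_trans[OF _ ennreal_less_top])
    hence g_fin: "AE x in P. g x \<noteq> \<infinity>" by (intro nn_integral_PInf_AE) auto
    define w where "w = (\<lambda>x. enn2real (g x))"
    have "integrable P w"
    proof (rule integrableI_nonneg)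
      have "(\<integral>\<^sup>+x. ennreal (w x) \<partial>P) \<le> (\<integral>\<^sup>+x. g x \<partial>P)"
        unfolding w_def by (intro nn_integral_mono) (simp add: ennreal_enn2real_if)
      thus "(\<integral>\<^sup>+x. ennreal (w x) \<partial>P) < \<infinity>" using g_int by (rule le_less_trans)
    qed (auto simp: w_def)
    moreover have "AE x in P. Y x > 0 \<and> (\<forall>k. U k x powr \<rho> \<le> w x)"
      using g_fin
    proof eventually_elim
      case (elim x)
      have w: "U k x powr \<rho> \<le> w x" for k
      proof -
        have "ennreal (U k x powr \<rho>) \<le> g x" unfolding g_def by (rule SUP_upper) auto
        also have "g x = ennreal (w x)" using elim by (simp add: w_def less_top)
        finally show ?thesis by (simp add: w_def)
      qed
      have "w x > 0" using w[of 0] U[of 0 x] by (smt (verit) powr_gt_zero)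
      \<comment> \<open>Because \<open>\<rho>\<close> is negative, the upper bound on
        \<open>U k x powr \<rho>\<close> inverts to a positive lower bound on \<open>U k x\<close>
        that is independent of \<open>k\<close> and survives the limit.\<close>
      have "w x powr (1 / \<rho>) \<le> U k x" for k
      proof -
        have "w x powr (1 / \<rho>) \<le> (U k x powr \<rho>) powr (1 / \<rho>)"
          using w[of k] \<rho> U[of k x] by (intro powr_mono2') auto
        thus ?thesis using \<rho> U[of k x] by (simp add: powr_powr)
      qed
      hence "w x powr (1 / \<rho>) \<le> Y x" using U_lim[of x] by (intro LIMSEQ_le_const) auto
      moreover have "w x powr (1 / \<rho>) > 0" using \<open>w x > 0\<close> by simp
      ultimately show ?case using w by (meson less_le_trans)
    qed
    ultimately show ?thesis by blast
  qed
  have Y_pos: "AE x in P. Y x > 0"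
    using dom[of "- b 0 / 2"] b0 by (auto elim: eventually_mono)
  have mellin_Y: "has_bochner_integral P (\<lambda>x. complex_of_real (Y x) powr q) (barnes_eta M N a b q)"
    if q: "Re q > - b 0" for q
  proof -
    \<comment> \<open>An exponent that is negative, as \<open>dom\<close> requires, and at most
      \<open>Re q\<close>: since \<open>U k x \<le> 1\<close>, lowering the exponent only increases
      the power, so \<open>w\<close> dominates.\<close>
    define \<rho> where "\<rho> = min (Re q) (- b 0 / 2)"
    have \<rho>: "- b 0 < \<rho>" "\<rho> < 0" "\<rho> \<le> Re q" using q b0 by (auto simp: \<rho>_def)
    obtain w where w: "integrable P w" "AE x in P. Y x > 0 \<and> (\<forall>k. U k x powr \<rho> \<le> w x)"
      using dom[OF \<rho>(1,2)] by blast
    have lim: "AE x in P. (\<lambda>k. complex_of_real (U k x) powr q) \<longlonglongrightarrow> complex_of_real (Y x) powr q"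
      using Y_pos
    proof eventually_elim
      case (elim x)
      thus ?case using U_lim[of x] by (intro tendsto_powr_complex tendsto_of_real tendsto_const) auto
    qed
    have bound: "AE x in P. norm (complex_of_real (U k x) powr q) \<le> w x" for k
      using w(2)
    proof eventually_elim
      case (elim x)
      have "norm (complex_of_real (U k x) powr q) = U k x powr Re q"
        using U[of k x] by (subst norm_powr_real_powr) auto
      also have "\<dots> \<le> U k x powr \<rho>" using U[of k x] \<rho>(3) by (intro powr_mono') auto
      finally show ?case using elim by (meson order_trans)
    qed
    have meas: "(\<lambda>x. complex_of_real (Y x) powr q) \<in> borel_measurable P"
      "(\<lambda>x. complex_of_real (U k x) powr q) \<in> borel_measurable P" for k by measurable
    have "(\<lambda>k. \<integral>x. complex_of_real (U k x) powr q \<partial>P) \<longlonglongrightarrow> (\<integral>x. complex_of_real (Y x) powr q \<partial>P)"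
      by (rule integral_dominated_convergence[OF meas w(1) lim bound])
    moreover have "(\<integral>x. complex_of_real (U k x) powr q \<partial>P) = (\<Prod>n\<in>F k. barnes_factor M N a b q n)" for k
      using mellin_U[OF q] by (rule has_bochner_integral_integral_eq)
    ultimately have "(\<integral>x. complex_of_real (Y x) powr q \<partial>P) = barnes_eta M N a b q"
      using lim_factor[OF q] LIMSEQ_unique by auto
    moreover have "integrable P (\<lambda>x. complex_of_real (Y x) powr q)"
      by (rule integrable_dominated_convergence[OF meas w(1) lim bound])
    ultimately show ?thesis by (simp add: has_bochner_integral_iff)
  qed
  have "barnes_beta_law M N a b (distr P borel Y)"
    unfolding barnes_beta_law_def
  proof (intro conjI allI impI)
    show "prob_space (distr P borel Y)" by (intro P.prob_space_distr) measurable
    have "AE x in P. 0 < Y x \<and> Y x \<le> 1"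
      using Y_pos by eventually_elim (use Y_le U(2) order_trans in blast)
    thus "AE x in distr P borel Y. 0 < x \<and> x \<le> 1" by (subst AE_distr_iff) auto
    show "has_bochner_integral (distr P borel Y) (\<lambda>x. complex_of_real x powr q) (barnes_eta M N a b q)"
      if "- b 0 < Re q" for q
      using mellin_Y[OF that] by (intro has_bochner_integral_distr) auto
  qed auto
  moreover have "AE x in P. ((\<lambda>G. \<Prod>n\<in>G. X n x) \<longlongrightarrow> Y x) (finite_subsets_at_top (multi_indices M))"
    using Z_eq
  proof eventually_elim
    case (elim x)
    show ?case unfolding I_def[symmetric]
    proof (rule Lim_transform_eventually[OF net])
      show "\<forall>\<^sub>F G in finite_subsets_at_top I. (\<Prod>n\<in>G. Z n x) = (\<Prod>n\<in>G. X n x)"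
        by (rule eventually_finite_subsets_at_top_weakI) (use elim in \<open>auto intro!: prod.cong\<close>)
    qed
  qed
  ultimately show ?thesis using Y_meas by blast
qed

theorem theorem4p5:
  fixes M N :: nat and a b :: "nat \<Rightarrow> real"
  assumes "M \<le> N"
    and "\<forall>i\<in>{1..M}. a i > 0"
    and "\<forall>j\<in>{0..N}. b j > 0"
  shows
    "(\<forall>q. q \<notin> complex_of_real ` {..- b 0} \<longrightarrow>
        ((\<lambda>F. \<Prod>n\<in>F. barnes_factor M N a b q n) \<longlongrightarrow> barnes_eta M N a b q)
          (finite_subsets_at_top (multi_indices M))) \<and>
     (\<forall>(P :: 'p measure) X.
        prob_space P \<and>
        prob_space.indep_vars P (\<lambda>_. borel) X (multi_indices M) \<and>
        (\<forall>n\<in>multi_indices M.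
           barnes_beta_law 0 N a (b(0 := b 0 + barnes_Omega M a n)) (distr P borel (X n))) \<longrightarrow>
        (\<exists>Y. Y \<in> borel_measurable P \<and>
           (AE x in P. ((\<lambda>F. \<Prod>n\<in>F. X n x) \<longlongrightarrow> Y x)
              (finite_subsets_at_top (multi_indices M))) \<and>
           (\<forall>D. barnes_beta_law M N a b D \<longleftrightarrow> D = distr P borel Y)))"
proof (intro conjI allI impI)
  fix q :: complex assume q: "q \<notin> complex_of_real ` {..- b 0}"
  have "q + of_real (b 0) \<in> slit_plane"
  proof (rule ComplI)
    assume "q + of_real (b 0) \<in> \<real>\<^sub>\<le>\<^sub>0"
    hence "Im q = 0" "Re q \<le> - b 0" by (auto simp: complex_nonpos_Reals_iff)
    hence "q = of_real (Re q)" "Re q \<in> {..- b 0}" by (auto simp: complex_eq_iff)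
    thus False using q by blast
  qed
  thus "((\<lambda>F. \<Prod>n\<in>F. barnes_factor M N a b q n) \<longlongrightarrow> barnes_eta M N a b q)
          (finite_subsets_at_top (multi_indices M))"
    using assms by (intro tendsto_prod_barnes_factor) auto
next
  fix P :: "'p measure" and X
  assume "prob_space P \<and> prob_space.indep_vars P (\<lambda>_. borel) X (multi_indices M) \<and>
    (\<forall>n\<in>multi_indices M.
       barnes_beta_law 0 N a (b(0 := b 0 + barnes_Omega M a n)) (distr P borel (X n)))"
  then obtain Y where Y: "Y \<in> borel_measurable P"
      "AE x in P. ((\<lambda>F. \<Prod>n\<in>F. X n x) \<longlongrightarrow> Y x) (finite_subsets_at_top (multi_indices M))"
      "barnes_beta_law M N a b (distr P borel Y)"
    using barnes_beta_product[OF assms, of P X] by blast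
  moreover have "barnes_beta_law M N a b D \<longleftrightarrow> D = distr P borel Y" for D
    using barnes_beta_law_unique[of b M N a D "distr P borel Y"] Y(3) assms(3) by auto
  ultimately show "\<exists>Y. Y \<in> borel_measurable P \<and>
           (AE x in P. ((\<lambda>F. \<Prod>n\<in>F. X n x) \<longlongrightarrow> Y x)
              (finite_subsets_at_top (multi_indices M))) \<and>
           (\<forall>D. barnes_beta_law M N a b D \<longleftrightarrow> D = distr P borel Y)" by blast
qed

end
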